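(* Let $f_i\in L^2(0,T;H^{-1}(\Omega_i))$ for $i=1,2$. Then the GA-VMS scheme described in the context is unconditionally stable (no restriction on the time step $\Delta t>0$), and its solution satisfies the following bound at time level $M+1$: $$ \begin{aligned} &\|u_{h,1}^{M+1}\|_{\Omega_1}^2+\|u_{h,2}^{M+1}\|_{\Omega_2}^2+\nu_T\Delta t\big(\|\nabla u_{h,1}^{M+1}\|_{\Omega_1}^2+\|\nabla u_{h,2}^{M+1}\|_{\Omega_2}^2\big)\\ &+\nu_1\Delta t\sum_{n=1}^M\|\nabla u_{h,1}^{n+1}\|_{\Omega_1}^2+\nu_2\Delta t\sum_{n=1}^M\|\nabla u_{h,2}^{n+1}\|_{\Omega_2}^2 +\kappa\Delta t\int_I|[\mathbf u_h^M]|\big(|u_{h,1}^{M+1}|^2+|u_{h,2}^{M+1}|^2\big)ds\\ &+\kappa\Delta t\sum_{n=1}^M\int_I\Big||[\mathbf u_h^n]|^{1/2}u_{h,1}^{n+1}-|[\mathbf u_h^{n-1}]|^{1/2}u_{h,2}^{n}\Big|^2ds +\kappa\Delta t\sum_{n=1}^M\int_I\Big||[\mathbf u_h^n]|^{1/2}u_{h,2}^{n+1}-|[\mathbf u_h^{n-1}]|^{1/2}u_{h,1}^{n}\Big|^2ds\\ \le\;&\|u_{h,1}^1\|_{\Omega_1}^2+\|u_{h,2}^1\|_{\Omega_2}^2+\kappa\Delta t\int_I|[\mathbf u_h^0]|\big(|u_{h,1}^1|^2+|u_{h,2}^1|^2\big)ds+\nu_T\Delta t\big(\|\nabla u_{h,1}^1\|_{\Omega_1}^2+\|\nabla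 u_{h,2}^1\|_{\Omega_2}^2\big)\\ &+\Delta t\sum_{n=1}^M\big(\nu_1^{-1}\|f_1^{n+1}\|_{-1,\Omega_1}^2+\nu_2^{-1}\|f_2^{n+1}\|_{-1,\Omega_2}^2\big). \end{aligned} $$
   Context: Setting. $d\in\{2,3\}$; $\Omega\subset\mathbb R^d$ is a polygonal or polyhedral domain consisting of two subdomains $\Omega_1,\Omega_2$ coupled across an interface $I$; $\hat n_i$ is the unit normal on $\partial\Omega_i$. Parameters: viscosities $\nu_1,\nu_2>0$, friction parameter $\kappa\in\mathbb R$, non-negative eddy viscosity $\nu_T$ depending on the mesh size $h$, time step $\Delta t$, time levels $t_n=n\Delta t$. The body forces $f_i$ are functions of time with $f_i^{n}=f_i(t_n)$ (values at all time levels used are understood to be given). Spaces. $X_i=\{v\in L^2(\Omega_i)^d:\nabla v\in L^2(\Omega_i)^{d\times d},\ v=0\text{ on }\partial\Omega_i\setminus I,\ v\cdot\hat n_i=0\text{ on }I\}$, $Q_i=L^2_0(\Omega_i)$ (mean-zero functions). $X_i^h\subset X_i$, $Q_i^h\subset Q_i$ are conforming finite element spaces satisfying the discrete inf-sup condition. $V_i^h=\{v\in X_i^h:(q,\nabla\cdot v)_{\Omega_i}=0\ \forall q\in Q_i^h\}$. $L_i^H$ is a finite dimensional space of $L^2$ functions on $\Omega_i$ with values in $\mathbb R^{d\times d}$ (the large scale space). $H^{-1}(\Omega_i)$ is the dual space of $H^1_0(\Omega_i)$ (for vector fields, of $H_0^1(\Omega_i)^d$), and $\|\cdot\|_{-1,\Omega_i}$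 is its dual norm, $\|f\|_{-1,\Omega_i}=\sup_{0\ne v\in H_0^1(\Omega_i)^d}(f,v)_{\Omega_i}/\|\nabla v\|_{\Omega_i}$. Notation. $(\cdot,\cdot)_{\Omega_i}$ and $\|\cdot\|_{\Omega_i}$ are the $L^2(\Omega_i)$ inner product and norm. For $\mathbf u=(u_1,u_2)$, $[\mathbf u]=u_1-u_2$ is the jump across $I$; $|\cdot|$ is the Euclidean norm; products of vectors in integrals over $I$ are Euclidean dot products. $\mathbf u_h^n=(u_{h,1}^n,u_{h,2}^n)$. The skew-symmetrized trilinear form is $c_i(u;v,w)=\frac12(u\cdot\nabla v,w)_{\Omega_i}-\frac12(u\cdot\nabla w,v)_{\Omega_i}$. GA-VMS scheme. Given starting values $u_{h,i}^0,u_{h,i}^1\in V_i^h$, for $n\ge1$ and $i,j\in\{1,2\}$, $i\ne j$, $u_{h,i}^{n+1}\in V_i^h$ and $\mathbb G_i^{\mathbb H,n}\in L_i^H$ satisfy, for all $v\in V_i^h$ and all $\mathbb L\in L_i^H$, $$\Big(\tfrac{u_{h,i}^{n+1}-u_{h,i}^n}{\Delta t},v\Big)_{\Omega_i}+(\nu_i+\nu_T)(\nabla u_{h,i}^{n+1},\nabla v)_{\Omega_i}+c_i(u_{h,i}^{n+1};u_{h,i}^{n+1},v)+\kappa\int_I|[\mathbf u_h^n]|\,u_{h,i}^{n+1}\cdot v\,ds-\kappa\int_I|[\mathbf u_h^n]|^{1/2}|[\mathbf u_h^{n-1}]|^{1/2}\,u_{h,j}^n\cdot v\,ds=(f_i^{n+1},v)_{\Omega_i}+\nu_T(\mathbb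 G_i^{\mathbb H,n},\nabla v)_{\Omega_i},$$ $$(\mathbb G_i^{\mathbb H,n}-\nabla u_{h,i}^n,\mathbb L)_{\Omega_i}=0 .$$
   Formalization: Since V_i^h is not contained in H^1_0, the pairing (f_i^{n+1},v) is undefined for f in H^{-1} (and the bound fails for some L^2 forces); it is read as a linear extension with |(f_i^{n+1},v)| ≤ ‖f_i^{n+1}‖_{-1}‖∇v‖ for all v in V_i^h. *)

theory Defs
  imports "HOL-Analysis.Analysis"
begin

text \<open>
  Functions on a domain are total functions on \<open>real ^ 'd\<close>, of which only the values inside the
  domain matter; elements of the L2-type spaces are represented by individual functions rather
  than by classes modulo null sets.
\<close>

section \<open>Lebesgue spaces\<close>

definition L2 :: "(real ^ 'd::finite) set \<Rightarrow> (real ^ 'd \<Rightarrow> 'b::euclidean_space) set" where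
  "L2 \<Omega> = {v. v \<in> borel_measurable (lebesgue_on \<Omega>) \<and>
              integrable (lebesgue_on \<Omega>) (\<lambda>x. (norm (v x))\<^sup>2)}"

definition L2_inner ::
    "(real ^ 'd::finite) set \<Rightarrow> (real ^ 'd \<Rightarrow> 'b::euclidean_space) \<Rightarrow> (real ^ 'd \<Rightarrow> 'b) \<Rightarrow> real" where
  "L2_inner \<Omega> v w = integral\<^sup>L (lebesgue_on \<Omega>) (\<lambda>x. v x \<bullet> w x)"

definition L2_norm :: "(real ^ 'd::finite) set \<Rightarrow> (real ^ 'd \<Rightarrow> 'b::euclidean_space) \<Rightarrow> real" where
  "L2_norm \<Omega> v = sqrt (L2_inner \<Omega> v v)"

definition L2_mean_zero :: "(real ^ 'd::finite) set \<Rightarrow> (real ^ 'd \<Rightarrow> real) set" where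
  "L2_mean_zero \<Omega> = {q \<in> L2 \<Omega>. integral\<^sup>L (lebesgue_on \<Omega>) q = 0}"

section \<open>Weak gradients and Sobolev spaces\<close>

definition partial_deriv :: "'d \<Rightarrow> (real ^ 'd::finite \<Rightarrow> real) \<Rightarrow> real ^ 'd \<Rightarrow> real" where
  "partial_deriv j \<phi> x = frechet_derivative \<phi> (at x) (axis j 1)"

definition smooth :: "(real ^ 'd::finite \<Rightarrow> real) \<Rightarrow> bool" where
  "smooth \<phi> \<longleftrightarrow> (\<forall>js x. foldr partial_deriv js \<phi> differentiable (at x))"

definition test_function :: "(real ^ 'd::finite) set \<Rightarrow> (real ^ 'd \<Rightarrow> real) \<Rightarrow> bool" where
  "test_function \<Omega> \<phi> \<longleftrightarrow> smooth \<phi> \<and> (\<exists>K. compact K \<and> K \<subseteq> \<Omega> \<and> (\<forall>x. x \<notin> K \<longrightarrow> \<phi> x = 0))"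

text \<open>The entry \<open>G x $ i $ j\<close> is the weak derivative of the \<open>i\<close>-th component in direction \<open>j\<close>;
  the inner product of \<open>real ^ 'd ^ 'd\<close> is the Frobenius product.\<close>

definition is_weak_grad ::
    "(real ^ 'd::finite) set \<Rightarrow> (real ^ 'd \<Rightarrow> real ^ 'd) \<Rightarrow> (real ^ 'd \<Rightarrow> real ^ 'd ^ 'd) \<Rightarrow> bool" where
  "is_weak_grad \<Omega> v G \<longleftrightarrow> G \<in> L2 \<Omega> \<and>
     (\<forall>\<phi>. test_function \<Omega> \<phi> \<longrightarrow> (\<forall>i j.
        integral\<^sup>L (lebesgue_on \<Omega>) (\<lambda>x. v x $ i * partial_deriv j \<phi> x) =
        - integral\<^sup>L (lebesgue_on \<Omega>) (\<lambda>x. G x $ i $ j * \<phi> x)))"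

definition grad :: "(real ^ 'd::finite) set \<Rightarrow> (real ^ 'd \<Rightarrow> real ^ 'd) \<Rightarrow> real ^ 'd \<Rightarrow> real ^ 'd ^ 'd" where
  "grad \<Omega> v = (SOME G. is_weak_grad \<Omega> v G)"

definition div_w :: "(real ^ 'd::finite) set \<Rightarrow> (real ^ 'd \<Rightarrow> real ^ 'd) \<Rightarrow> real ^ 'd \<Rightarrow> real" where
  "div_w \<Omega> v x = trace (grad \<Omega> v x)"

definition H1 :: "(real ^ 'd::finite) set \<Rightarrow> (real ^ 'd \<Rightarrow> real ^ 'd) set" where
  "H1 \<Omega> = {v \<in> L2 \<Omega>. \<exists>G. is_weak_grad \<Omega> v G}"

definition H10 :: "(real ^ 'd::finite) set \<Rightarrow> (real ^ 'd \<Rightarrow> real ^ 'd) set" where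
  "H10 \<Omega> = {v \<in> H1 \<Omega>. \<exists>\<phi> :: nat \<Rightarrow> real ^ 'd \<Rightarrow> real ^ 'd.
      (\<forall>k i. test_function \<Omega> (\<lambda>x. \<phi> k x $ i)) \<and>
      (\<lambda>k. L2_norm \<Omega> (\<lambda>x. v x - \<phi> k x)) \<longlonglongrightarrow> 0 \<and>
      (\<lambda>k. L2_norm \<Omega> (\<lambda>x. grad \<Omega> v x - grad \<Omega> (\<phi> k) x)) \<longlonglongrightarrow> 0}"

section \<open>The dual space of \<open>H10\<close>\<close>

definition linear_form_on :: "('a \<Rightarrow> 'b::real_vector) set \<Rightarrow> (('a \<Rightarrow> 'b) \<Rightarrow> real) \<Rightarrow> bool" where
  "linear_form_on S F \<longleftrightarrow>
     (\<forall>v\<in>S. \<forall>w\<in>S. \<forall>a b. F (\<lambda>x. a *\<^sub>R v x + b *\<^sub>R w x) = a * F v + b * F w)"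

definition Hm1 :: "(real ^ 'd::finite) set \<Rightarrow> ((real ^ 'd \<Rightarrow> real ^ 'd) \<Rightarrow> real) set" where
  "Hm1 \<Omega> = {F. linear_form_on (H10 \<Omega>) F \<and>
                (\<exists>C. \<forall>v \<in> H10 \<Omega>. \<bar>F v\<bar> \<le> C * L2_norm \<Omega> (grad \<Omega> v))}"

definition Hm1_norm :: "(real ^ 'd::finite) set \<Rightarrow> ((real ^ 'd \<Rightarrow> real ^ 'd) \<Rightarrow> real) \<Rightarrow> real" where
  "Hm1_norm \<Omega> F =
     (SUP v \<in> {v \<in> H10 \<Omega>. \<not> (AE x in lebesgue_on \<Omega>. v x = 0)}. F v / L2_norm \<Omega> (grad \<Omega> v))"

text \<open>
  The test spaces of the scheme are not contained in \<open>H10 \<Omega>\<close>, as only the normal component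
  vanishes on the interface, so the pairing of a functional in \<open>Hm1 \<Omega>\<close> with such a test field is
  not determined by the functional on \<open>H10 \<Omega>\<close> alone. It is read as the pairing with a
  norm-preserving (Hahn-Banach) linear extension to \<open>H10 \<Omega> + W\<close>, the bound being needed on \<open>W\<close>
  only. Without norm preservation, a force concentrated in a thin layer at the interface has an
  arbitrarily small \<open>Hm1_norm\<close> but a non-negligible action on \<open>W\<close>.
\<close>

definition Hm1_acting_on ::
    "(real ^ 'd::finite) set \<Rightarrow> (real ^ 'd \<Rightarrow> real ^ 'd) set \<Rightarrow> ((real ^ 'd \<Rightarrow> real ^ 'd) \<Rightarrow> real) set" where
  "Hm1_acting_on \<Omega> W = {F \<in> Hm1 \<Omega>.
      linear_form_on {\<lambda>x. v x + w x | v w. v \<in> H10 \<Omega> \<and> w \<in> W} F \<and>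
      (\<forall>w \<in> W. \<bar>F w\<bar> \<le> Hm1_norm \<Omega> F * L2_norm \<Omega> (grad \<Omega> w))}"

text \<open>Bochner measurability is stated weakly, which is equivalent by Pettis' theorem because the
  dual of the separable Hilbert space \<open>H10 \<Omega>\<close> is separable and reflexive.\<close>

definition L2_time_Hm1 ::
    "real \<Rightarrow> (real ^ 'd::finite) set \<Rightarrow> (real \<Rightarrow> (real ^ 'd \<Rightarrow> real ^ 'd) \<Rightarrow> real) set" where
  "L2_time_Hm1 T \<Omega> = {f.
      (AE t in lebesgue_on {0<..<T}. f t \<in> Hm1 \<Omega>) \<and>
      (\<forall>v \<in> H10 \<Omega>. (\<lambda>t. f t v) \<in> borel_measurable (lebesgue_on {0<..<T})) \<and>
      integrable (lebesgue_on {0<..<T}) (\<lambda>t. (Hm1_norm \<Omega> (f t))\<^sup>2)}"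

section \<open>Surface measure, boundary traces, normals\<close>

definition hausdorff_outer :: "nat \<Rightarrow> (real ^ 'd::finite) set \<Rightarrow> ennreal" where
  "hausdorff_outer s A = (SUP \<delta> \<in> {0::real<..}.
     INF C \<in> {C :: nat \<Rightarrow> (real ^ 'd) set.
                A \<subseteq> (\<Union>k. C k) \<and> (\<forall>k. bounded (C k) \<and> diameter (C k) \<le> \<delta>)}.
       (\<Sum>k. ennreal (unit_ball_vol (real s) * (diameter (C k) / 2) ^ s)))"

definition surface_measure :: "(real ^ 'd::finite) measure" where
  "surface_measure = completion (measure_of UNIV (sets borel) (hausdorff_outer (CARD('d) - 1)))"

text \<open>Boundary traces of Sobolev functions as limits of averages over shrinking one-sided
  neighbourhoods (Evans-Gariepy, Theorem 5.7; Ambrosio-Fusco-Pallara, Theorem 3.87). On Lipschitz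
  domains this agrees almost everywhere with the value of the trace operator.\<close>

definition has_trace_at ::
    "(real ^ 'd::finite) set \<Rightarrow> (real ^ 'd \<Rightarrow> real ^ 'd) \<Rightarrow> real ^ 'd \<Rightarrow> real ^ 'd \<Rightarrow> bool" where
  "has_trace_at \<Omega> v x a \<longleftrightarrow>
     ((\<lambda>r. integral\<^sup>L (lebesgue_on (\<Omega> \<inter> ball x r)) (\<lambda>y. norm (v y - a))
            / measure lebesgue (\<Omega> \<inter> ball x r)) \<longlongrightarrow> 0) (at_right 0)"

definition btrace :: "(real ^ 'd::finite) set \<Rightarrow> (real ^ 'd \<Rightarrow> real ^ 'd) \<Rightarrow> real ^ 'd \<Rightarrow> real ^ 'd" where
  "btrace \<Omega> v x =
     (if \<exists>a. has_trace_at \<Omega> v x a then SOME a. has_trace_at \<Omega> v x a else 0)"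

text \<open>On a polyhedral domain this determines the normal at almost every boundary point, namely in
  the relative interior of each face.\<close>

definition outer_normal :: "(real ^ 'd::finite) set \<Rightarrow> real ^ 'd \<Rightarrow> real ^ 'd \<Rightarrow> bool" where
  "outer_normal \<Omega> x n \<longleftrightarrow> norm n = 1 \<and>
     (\<exists>e>0. \<Omega> \<inter> ball x e = {y \<in> ball x e. (y - x) \<bullet> n < 0})"

section \<open>The coupled domain and its function spaces\<close>

definition polyhedral_domain :: "(real ^ 'd::finite) set \<Rightarrow> bool" where
  "polyhedral_domain \<Omega> \<longleftrightarrow> open \<Omega> \<and> connected \<Omega> \<and> \<Omega> \<noteq> {} \<and>
     (\<exists>P. finite P \<and> (\<forall>K\<in>P. polytope K) \<and> closure \<Omega> = \<Union>P \<and> \<Omega> = interior (\<Union>P))"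

definition coupled_domains ::
    "(real ^ 'd::finite) set \<Rightarrow> (nat \<Rightarrow> (real ^ 'd) set) \<Rightarrow> (real ^ 'd) set \<Rightarrow> bool" where
  "coupled_domains D \<Omega> I \<longleftrightarrow>
     polyhedral_domain D \<and> polyhedral_domain (\<Omega> 1) \<and> polyhedral_domain (\<Omega> 2) \<and>
     \<Omega> 1 \<inter> \<Omega> 2 = {} \<and> closure D = closure (\<Omega> 1) \<union> closure (\<Omega> 2) \<and>
     I = frontier (\<Omega> 1) \<inter> frontier (\<Omega> 2)"

definition X_space ::
    "(real ^ 'd::finite) set \<Rightarrow> (real ^ 'd) set \<Rightarrow> (real ^ 'd \<Rightarrow> real ^ 'd) set" where
  "X_space \<Omega> I = {v \<in> H1 \<Omega>.
     (AE x in surface_measure. x \<in> frontier \<Omega> - I \<longrightarrow> has_trace_at \<Omega> v x 0) \<and>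
     (AE x in surface_measure. x \<in> I \<longrightarrow>
        (\<exists>a. has_trace_at \<Omega> v x a \<and> (\<forall>n. outer_normal \<Omega> x n \<longrightarrow> a \<bullet> n = 0)))}"

definition fin_dim_space :: "('a \<Rightarrow> 'b::real_vector) set \<Rightarrow> bool" where
  "fin_dim_space S \<longleftrightarrow>
     (\<exists>N b. S = range (\<lambda>c :: nat \<Rightarrow> real. \<lambda>x. \<Sum>k<N. c k *\<^sub>R b k x))"

definition mesh_of :: "(real ^ 'd::finite) set \<Rightarrow> (real ^ 'd) set set \<Rightarrow> bool" where
  "mesh_of \<Omega> \<T> \<longleftrightarrow> finite \<T> \<and> (\<forall>K\<in>\<T>. polytope K \<and> interior K \<noteq> {}) \<and>
     pairwise (\<lambda>K K'. interior K \<inter> interior K' = {}) \<T> \<and> \<Union>\<T> = closure \<Omega>"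

text \<open>Shape functions are only required to be continuous on the closed cells, which includes
  piecewise polynomials of any degree as well as mapped elements.\<close>

definition fe_space ::
    "(real ^ 'd::finite) set set \<Rightarrow> (real ^ 'd \<Rightarrow> 'b::real_normed_vector) set \<Rightarrow> bool" where
  "fe_space \<T> S \<longleftrightarrow> fin_dim_space S \<and>
     (\<forall>v\<in>S. \<forall>K\<in>\<T>. \<exists>p. continuous_on K p \<and> (\<forall>x\<in>interior K. v x = p x))"

text \<open>The supremum is taken in the extended reals, so that no boundedness is presupposed.\<close>

definition inf_sup_condition ::
    "(real ^ 'd::finite) set \<Rightarrow> (real ^ 'd \<Rightarrow> real ^ 'd) set \<Rightarrow> (real ^ 'd \<Rightarrow> real) set \<Rightarrow> bool" where
  "inf_sup_condition \<Omega> Xh Qh \<longleftrightarrow> (\<exists>\<beta>>0. \<forall>q\<in>Qh. L2_norm \<Omega> q \<noteq> 0 \<longrightarrow>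
     ereal \<beta> \<le> (SUP v \<in> {v \<in> Xh. L2_norm \<Omega> (grad \<Omega> v) \<noteq> 0}.
        ereal (L2_inner \<Omega> q (div_w \<Omega> v) / (L2_norm \<Omega> q * L2_norm \<Omega> (grad \<Omega> v)))))"

definition conforming_fe_pair ::
    "(real ^ 'd::finite) set \<Rightarrow> (real ^ 'd) set \<Rightarrow> (real ^ 'd) set set \<Rightarrow>
     (real ^ 'd \<Rightarrow> real ^ 'd) set \<Rightarrow> (real ^ 'd \<Rightarrow> real) set \<Rightarrow> bool" where
  "conforming_fe_pair \<Omega> I \<T> Xh Qh \<longleftrightarrow>
     mesh_of \<Omega> \<T> \<and> fe_space \<T> Xh \<and> fe_space \<T> Qh \<and>
     Xh \<subseteq> X_space \<Omega> I \<and> Qh \<subseteq> L2_mean_zero \<Omega> \<and> inf_sup_condition \<Omega> Xh Qh"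

definition V_space ::
    "(real ^ 'd::finite) set \<Rightarrow> (real ^ 'd \<Rightarrow> real ^ 'd) set \<Rightarrow> (real ^ 'd \<Rightarrow> real) set \<Rightarrow>
     (real ^ 'd \<Rightarrow> real ^ 'd) set" where
  "V_space \<Omega> Xh Qh = {v \<in> Xh. \<forall>q\<in>Qh. L2_inner \<Omega> q (div_w \<Omega> v) = 0}"

section \<open>The scheme\<close>

definition trilinear ::
    "(real ^ 'd::finite) set \<Rightarrow> (real ^ 'd \<Rightarrow> real ^ 'd) \<Rightarrow> (real ^ 'd \<Rightarrow> real ^ 'd) \<Rightarrow>
     (real ^ 'd \<Rightarrow> real ^ 'd) \<Rightarrow> real" where
  "trilinear \<Omega> u v w =
     1/2 * L2_inner \<Omega> (\<lambda>x. grad \<Omega> v x *v u x) w - 1/2 * L2_inner \<Omega> (\<lambda>x. grad \<Omega> w x *v u x) v"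

definition surface_integral :: "(real ^ 'd::finite) set \<Rightarrow> (real ^ 'd \<Rightarrow> real) \<Rightarrow> real" where
  "surface_integral I g = (LINT x:I|surface_measure. g x)"

text \<open>The discrete velocity \<open>u i n\<close> lives on \<open>\<Omega> i\<close> at time level \<open>n\<close>, with \<open>i \<in> {1, 2}\<close>.\<close>

definition jump_norm ::
    "(nat \<Rightarrow> (real ^ 'd::finite) set) \<Rightarrow> (nat \<Rightarrow> nat \<Rightarrow> real ^ 'd \<Rightarrow> real ^ 'd) \<Rightarrow>
     nat \<Rightarrow> real ^ 'd \<Rightarrow> real" where
  "jump_norm \<Omega> u n x = norm (btrace (\<Omega> 1) (u 1 n) x - btrace (\<Omega> 2) (u 2 n) x)"

definition gavms_step ::
    "(nat \<Rightarrow> (real ^ 'd::finite) set) \<Rightarrow> (real ^ 'd) set \<Rightarrow>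
     (nat \<Rightarrow> (real ^ 'd \<Rightarrow> real ^ 'd) set) \<Rightarrow> (nat \<Rightarrow> (real ^ 'd \<Rightarrow> real ^ 'd ^ 'd) set) \<Rightarrow>
     (nat \<Rightarrow> real) \<Rightarrow> real \<Rightarrow> real \<Rightarrow> real \<Rightarrow>
     (nat \<Rightarrow> real \<Rightarrow> (real ^ 'd \<Rightarrow> real ^ 'd) \<Rightarrow> real) \<Rightarrow>
     (nat \<Rightarrow> nat \<Rightarrow> real ^ 'd \<Rightarrow> real ^ 'd) \<Rightarrow> (nat \<Rightarrow> nat \<Rightarrow> real ^ 'd \<Rightarrow> real ^ 'd ^ 'd) \<Rightarrow>
     nat \<Rightarrow> nat \<Rightarrow> nat \<Rightarrow> bool" where
  "gavms_step \<Omega> I Vh LH \<nu> \<nu>T \<kappa> dt f u G n i j \<longleftrightarrow>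
     u i (n + 1) \<in> Vh i \<and> G i n \<in> LH i \<and>
     (\<forall>v \<in> Vh i.
        L2_inner (\<Omega> i) (\<lambda>x. (u i (n + 1) x - u i n x) /\<^sub>R dt) v
        + (\<nu> i + \<nu>T) * L2_inner (\<Omega> i) (grad (\<Omega> i) (u i (n + 1))) (grad (\<Omega> i) v)
        + trilinear (\<Omega> i) (u i (n + 1)) (u i (n + 1)) v
        + \<kappa> * surface_integral I (\<lambda>x. jump_norm \<Omega> u n x *
              (btrace (\<Omega> i) (u i (n + 1)) x \<bullet> btrace (\<Omega> i) v x))
        - \<kappa> * surface_integral I (\<lambda>x. sqrt (jump_norm \<Omega> u n x) * sqrt (jump_norm \<Omega> u (n - 1) x) *
              (btrace (\<Omega> j) (u j n) x \<bullet> btrace (\<Omega> i) v x))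
        = f i (real (n + 1) * dt) v + \<nu>T * L2_inner (\<Omega> i) (G i n) (grad (\<Omega> i) v)) \<and>
     (\<forall>L \<in> LH i. L2_inner (\<Omega> i) (\<lambda>x. G i n x - grad (\<Omega> i) (u i n) x) L = 0)"

text \<open>A solution up to time level \<open>M + 1\<close>, including its starting values.\<close>

definition gavms_solution ::
    "(nat \<Rightarrow> (real ^ 'd::finite) set) \<Rightarrow> (real ^ 'd) set \<Rightarrow>
     (nat \<Rightarrow> (real ^ 'd \<Rightarrow> real ^ 'd) set) \<Rightarrow> (nat \<Rightarrow> (real ^ 'd \<Rightarrow> real ^ 'd ^ 'd) set) \<Rightarrow>
     (nat \<Rightarrow> real) \<Rightarrow> real \<Rightarrow> real \<Rightarrow> real \<Rightarrow>
     (nat \<Rightarrow> real \<Rightarrow> (real ^ 'd \<Rightarrow> real ^ 'd) \<Rightarrow> real) \<Rightarrow>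
     (nat \<Rightarrow> nat \<Rightarrow> real ^ 'd \<Rightarrow> real ^ 'd) \<Rightarrow> (nat \<Rightarrow> nat \<Rightarrow> real ^ 'd \<Rightarrow> real ^ 'd ^ 'd) \<Rightarrow>
     nat \<Rightarrow> bool" where
  "gavms_solution \<Omega> I Vh LH \<nu> \<nu>T \<kappa> dt f u G M \<longleftrightarrow>
     (\<forall>i\<in>{1, 2}. u i 0 \<in> Vh i \<and> u i 1 \<in> Vh i) \<and>
     (\<forall>n\<in>{1..M}. \<forall>i\<in>{1, 2}. \<forall>j\<in>{1, 2}. i \<noteq> j \<longrightarrow>
        gavms_step \<Omega> I Vh LH \<nu> \<nu>T \<kappa> dt f u G n i j)"

end

theory Submission
  imports Defs
begin

text \<open>
  Testing each equation with the new velocity removes the convection term, and twice the interface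
  terms become \<open>\<bar>p\<bar>\<^sup>2 - \<bar>q\<bar>\<^sup>2 + \<bar>p - q\<bar>\<^sup>2\<close> with
  \<open>p = \<surd>\<bar>[u\<^sup>n]\<bar> u\<^sub>i\<^sup>n\<^sup>+\<^sup>1\<close> and \<open>q = \<surd>\<bar>[u\<^sup>n\<^sup>-\<^sup>1]\<bar> u\<^sub>j\<^sup>n\<close>, so that after summation over \<open>i\<close>
  the interface energy telescopes. The eddy viscosity term telescopes because the large scale
  gradient is an orthogonal projection of the previous gradient.

  Splitting the interface integrals requires integrability (other functions have integral 0): the
  interface lies in finitely many facets and thus has finite surface measure, and the traces of the
  finite element functions are bounded and, as limits of averages over balls, measurable.
\<close>

section \<open>Finiteness of the surface measure on polyhedral boundaries\<close>

text \<open>Counting cells replaces the infimum over countable covers: a finite cover by pieces of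
  diameter at most \<open>d\<close>, padded with empty sets, is admissible at scale
  \<open>\<delta>\<close>. The halving of the diameters is given up. As \<open>B\<close> does not
  depend on \<open>\<delta>\<close>, the bound survives the supremum.\<close>

lemma hausdorff_outer_le_card_mult:
  fixes A :: "(real ^ 'd::finite) set" and B :: real
  assumes s: "s > 0"
    and cover: "\<And>\<delta>. \<delta> > 0 \<Longrightarrow>
        \<exists>S (cell :: 'i \<Rightarrow> (real ^ 'd) set) (d :: real). finite S \<and> A \<subseteq> (\<Union>g\<in>S. cell g) \<and>
        (\<forall>g\<in>S. bounded (cell g) \<and> diameter (cell g) \<le> d) \<and> 0 \<le> d \<and> d \<le> \<delta> \<and> card S * d ^ s \<le> B"
  shows "hausdorff_outer s A \<le> ennreal (unit_ball_vol (real s) * B)"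
  unfolding hausdorff_outer_def
proof (rule SUP_least)
  fix \<delta> :: real assume "\<delta> \<in> {0<..}"
  then obtain S and d :: real and cell :: "'i \<Rightarrow> (real ^ 'd) set" where S: "finite S" "A \<subseteq> (\<Union>g\<in>S. cell g)"
    and cell: "\<forall>g\<in>S. bounded (cell g) \<and> diameter (cell g) \<le> d"
    and d: "0 \<le> d" "d \<le> \<delta>" "card S * d ^ s \<le> B"
    using cover[of \<delta>] unfolding greaterThan_iff by blast
  obtain h where h: "bij_betw h {..<card S} S"
    using ex_bij_betw_nat_finite[OF S(1)] by (auto simp: atLeast0LessThan)
  have h_mem: "h k \<in> S" if "k < card S" for k
    using h that by (auto simp: bij_betw_def)
  define C where "C k = (if k < card S then cell (h k) else {})" for k
  let ?w = "\<lambda>k. ennreal (unit_ball_vol (real s) * (diameter (C k) / 2) ^ s)"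
  have "cell g \<subseteq> (\<Union>k. C k)" if "g \<in> S" for g
  proof -
    from h that obtain k where "k < card S" "h k = g"
      by (force simp: bij_betw_def)
    then show ?thesis by (auto simp: C_def)
  qed
  with S(2) have "A \<subseteq> (\<Union>k. C k)" by (meson UN_least order.trans)
  moreover have "bounded (C k) \<and> diameter (C k) \<le> \<delta>" for k
    using cell h_mem d by (auto simp: C_def intro: order.trans)
  ultimately have "(INF C \<in> {C :: nat \<Rightarrow> (real ^ 'd) set. A \<subseteq> (\<Union>k. C k) \<and>
      (\<forall>k. bounded (C k) \<and> diameter (C k) \<le> \<delta>)}.
       (\<Sum>k. ennreal (unit_ball_vol (real s) * (diameter (C k) / 2) ^ s))) \<le> (\<Sum>k. ?w k)"
    by (intro INF_lower) auto
  \<comment> \<open>The padding has diameter 0, and \<open>s > 0\<close> makes its weight vanish;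
    for \<open>s = 0\<close> each empty set would count \<open>0 ^ 0 = 1\<close>.\<close>
  also have "(\<Sum>k. ?w k) = (\<Sum>k<card S. ?w k)"
    using s by (intro suminf_finite) (auto simp: C_def)
  also have "\<dots> \<le> (\<Sum>k<card S. ennreal (unit_ball_vol (real s) * d ^ s))"
  proof (intro sum_mono ennreal_leI mult_left_mono power_mono)
    fix k assume "k \<in> {..<card S}"
    then have "bounded (C k)" "diameter (C k) \<le> d" using cell h_mem by (auto simp: C_def)
    then show "diameter (C k) / 2 \<le> d" "0 \<le> diameter (C k) / 2"
      using diameter_ge_0[of "C k"] by linarith+
  qed auto
  also have "\<dots> = ennreal (unit_ball_vol (real s) * (card S * d ^ s))"
    by (simp add: ennreal_of_nat_eq_real_of_nat ennreal_mult[symmetric] d mult_ac)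
  also have "\<dots> \<le> ennreal (unit_ball_vol (real s) * B)"
    using d by (intro ennreal_leI mult_left_mono) auto
  finally show "(INF C \<in> {C :: nat \<Rightarrow> (real ^ 'd) set. A \<subseteq> (\<Union>k. C k) \<and>
      (\<forall>k. bounded (C k) \<and> diameter (C k) \<le> \<delta>)}.
       (\<Sum>k. ennreal (unit_ball_vol (real s) * (diameter (C k) / 2) ^ s)))
       \<le> ennreal (unit_ball_vol (real s) * B)" .
qed

text \<open>The equation of the hyperplane can be solved for coordinate \<open>i\<close>. As
  \<open>a $ i\<close> has maximal size, all coefficient ratios are at most 1 in absolute value, so
  the other coordinates control this one; the l1 norm dominates the Euclidean norm.\<close>

lemma norm_diff_le_on_hyperplane:
  fixes a x y :: "real ^ 'd::finite"
  assumes max: "\<And>j. \<bar>a $ j\<bar> \<le> \<bar>a $ i\<bar>" and "a $ i \<noteq> 0" and "a \<bullet> x = a \<bullet> y"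
  shows "norm (x - y) \<le> 2 * (\<Sum>k\<in>UNIV - {i}. \<bar>x $ k - y $ k\<bar>)"
proof -
  have "0 = a \<bullet> (x - y)" using assms by (simp add: inner_diff_right)
  also have "\<dots> = a $ i * (x $ i - y $ i) + (\<Sum>k\<in>UNIV - {i}. a $ k * (x $ k - y $ k))"
    by (simp add: inner_vec_def sum.remove[of UNIV i])
  finally have "\<bar>a $ i\<bar> * \<bar>x $ i - y $ i\<bar> = \<bar>\<Sum>k\<in>UNIV - {i}. a $ k * (x $ k - y $ k)\<bar>"
    by (simp add: abs_mult[symmetric])
  also have "\<dots> \<le> (\<Sum>k\<in>UNIV - {i}. \<bar>a $ i\<bar> * \<bar>x $ k - y $ k\<bar>)"
    by (rule order.trans[OF sum_abs]) (auto intro!: sum_mono mult_right_mono max simp: abs_mult)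
  finally have "\<bar>x $ i - y $ i\<bar> \<le> (\<Sum>k\<in>UNIV - {i}. \<bar>x $ k - y $ k\<bar>)"
    using assms(2) by (simp add: sum_distrib_left[symmetric])
  moreover have "norm (x - y) \<le> \<bar>x $ i - y $ i\<bar> + (\<Sum>k\<in>UNIV - {i}. \<bar>x $ k - y $ k\<bar>)"
    using norm_le_l1_cart[of "x - y"] by (simp add: sum.remove[of UNIV i])
  ultimately show ?thesis by linarith
qed

text \<open>A hyperplane is a Lipschitz graph over the coordinate directions other than one in which the
  normal has a component of maximal size, so a grid in those directions covers the set.\<close>

lemma hausdorff_outer_bounded_hyperplane:
  fixes A :: "(real ^ 'd::finite) set"
  assumes "bounded A" and "a \<noteq> 0" and A: "A \<subseteq> {x. a \<bullet> x = b}" and card: "CARD('d) \<ge> 2"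
  shows "hausdorff_outer (CARD('d) - 1) A < \<infinity>"
proof -
  define m where "m = CARD('d) - 1"
  have "Max (range (\<lambda>j. \<bar>a $ j\<bar>)) \<in> range (\<lambda>j. \<bar>a $ j\<bar>)" by (rule Max_in) auto
  then obtain i where "Max (range (\<lambda>j. \<bar>a $ j\<bar>)) = \<bar>a $ i\<bar>" by (rule imageE)
  then have max: "\<bar>a $ j\<bar> \<le> \<bar>a $ i\<bar>" for j
    using Max_ge[of "range (\<lambda>j. \<bar>a $ j\<bar>)" "\<bar>a $ j\<bar>"] by simp
  have ai: "a $ i \<noteq> 0" 
  proof
    assume "a $ i = 0"
    then have "a $ j = 0" for j using max[of j] by simp
    then show False using \<open>a \<noteq> 0\<close> by (simp add: vec_eq_iff)
  qed
  obtain R where R: "\<And>x. x \<in> A \<Longrightarrow> norm x \<le> R" using \<open>bounded A\<close> by (auto simp: bounded_iff)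
  obtain r :: nat where r: "R \<le> real r" using real_arch_simple by blast
  let ?J = "UNIV - {i}"
  have card_J: "card ?J = m" by (simp add: m_def card_Diff_singleton)
  have "m > 0" using card by (simp add: m_def)
  \<comment> \<open>A grid of width \<open>1 / N\<close> has \<open>(2 * N * r + 1) ^ m\<close>
    cells of diameter at most \<open>2 * m / N\<close>. For \<open>N \<ge> 1\<close> the count times
    the \<open>m\<close>-th power of the diameter bound stays below this value.\<close>
  define B where "B = ((2 * real r + 1) * (2 * m)) ^ m"
  have "hausdorff_outer m A \<le> ennreal (unit_ball_vol (real m) * B)"
  proof (rule hausdorff_outer_le_card_mult[where 'i = "'d \<Rightarrow> int"])
    fix \<delta> :: real assume "\<delta> > 0"
    obtain N0 :: nat where N0: "2 * m / \<delta> < real N0" using reals_Archimedean2 by blast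
    define N where "N = Suc N0"
    have "2 * m < N0 * \<delta>" using N0 \<open>\<delta> > 0\<close> by (simp add: pos_divide_less_eq)
    also have "\<dots> \<le> N * \<delta>" using \<open>\<delta> > 0\<close> by (simp add: N_def)
    finally have N: "N \<ge> 1" "2 * m / N \<le> \<delta>"
      by (simp_all add: N_def pos_divide_le_eq mult.commute)
    \<comment> \<open>Members of \<open>PiE\<close> are \<open>undefined\<close> at
      \<open>i\<close>, which keeps the index set finite. The range contains all floors because
      coordinates of points of \<open>A\<close> are at most \<open>r\<close> in absolute
      value.\<close>
    define S where "S = PiE ?J (\<lambda>_. {- int (N * r)..int (N * r)})"
    define cell where "cell g = {x \<in> A. \<forall>k\<in>?J. \<lfloor>N * x $ k\<rfloor> = g k}" for g :: "'d \<Rightarrow> int"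
    have "card {- int k..int k} = 2 * k + 1" for k :: nat
      unfolding card_atLeastAtMost_int by linarith
    from this[of "N * r"] have "card S = (2 * N * r + 1) ^ m"
      unfolding S_def by (subst card_PiE) (simp_all only: finite_Diff finite prod_constant card_J mult.assoc)
    moreover have "finite S" unfolding S_def by (intro finite_PiE) simp_all
    moreover have "A \<subseteq> (\<Union>g\<in>S. cell g)"
    proof
      fix x assume x: "x \<in> A"
      define g where "g = restrict (\<lambda>k. \<lfloor>N * x $ k\<rfloor>) ?J"
      have "\<lfloor>N * x $ k\<rfloor> \<in> {- int (N * r)..int (N * r)}" for k
      proof -
        have "\<bar>x $ k\<bar> \<le> r" using R[OF x] r component_le_norm_cart[of x k] by linarith
        then have "\<bar>N * x $ k\<bar> \<le> N * r" by (simp add: abs_mult mult_left_mono)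
        then show ?thesis by (simp add: le_floor_iff floor_le_iff) linarith
      qed
      then have "g \<in> S" "x \<in> cell g" using x by (auto simp: S_def g_def cell_def)
      then show "x \<in> (\<Union>g\<in>S. cell g)" by blast
    qed
    \<comment> \<open>Equal floors bring each of the \<open>m\<close> free coordinates within
      \<open>1 / N\<close>; the factor 2 is that of the hyperplane estimate.\<close>
    moreover have "diameter (cell g) \<le> 2 * m / N" for g
    proof (rule diameter_le)
      fix x y assume xy: "x \<in> cell g" "y \<in> cell g"
      have "\<bar>x $ k - y $ k\<bar> \<le> 1 / N" if "k \<in> ?J" for k
      proof -
        have "\<lfloor>N * x $ k\<rfloor> = \<lfloor>N * y $ k\<rfloor>" using xy that by (simp add: cell_def)
        then have "\<bar>N * x $ k - N * y $ k\<bar> \<le> 1" by linarith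
        then have "N * \<bar>x $ k - y $ k\<bar> \<le> 1"
          by (simp add: abs_mult flip: right_diff_distrib)
        then show ?thesis using N by (simp add: field_simps)
      qed
      then have "(\<Sum>k\<in>?J. \<bar>x $ k - y $ k\<bar>) \<le> (\<Sum>k\<in>?J. 1 / N)" by (rule sum_mono)
      also have "\<dots> = m / N" by (simp only: sum_constant card_J) simp
      finally have sum_le: "(\<Sum>k\<in>?J. \<bar>x $ k - y $ k\<bar>) \<le> m / N" .
      have "x \<in> A" "y \<in> A" using xy by (simp_all add: cell_def)
      then have "a \<bullet> x = b" "a \<bullet> y = b" using A by blast+
      then have "norm (x - y) \<le> 2 * (\<Sum>k\<in>?J. \<bar>x $ k - y $ k\<bar>)"
        by (intro norm_diff_le_on_hyperplane[OF max ai]) simp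
      with sum_le show "norm (x - y) \<le> 2 * m / N" by linarith
    qed auto
    moreover have "bounded (cell g)" for g
      using \<open>bounded A\<close> by (rule bounded_subset) (auto simp: cell_def)
    moreover have "real ((2 * N * r + 1) ^ m) * (2 * m / N) ^ m \<le> B"
    proof -
      have "(2 * real N * r + 1) * (2 * m / N) \<le> (2 * real r + 1) * (2 * m)"
      proof -
        have "(2 * real N * r + 1) / N \<le> 2 * real r + 1"
          using N by (simp add: pos_divide_le_eq algebra_simps)
        then have "(2 * real N * r + 1) / N * (2 * m) \<le> (2 * real r + 1) * (2 * m)"
          by (rule mult_right_mono) simp
        then show ?thesis by simp
      qed
      then have "((2 * real N * r + 1) * (2 * m / N)) ^ m \<le> B"
        unfolding B_def by (intro power_mono) auto
      moreover have "real ((2 * N * r + 1) ^ m) = (2 * real N * r + 1) ^ m"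
        by (simp add: add.commute)
      ultimately show ?thesis by (simp only: power_mult_distrib)
    qed
    ultimately show "\<exists>S (cell :: ('d \<Rightarrow> int) \<Rightarrow> (real ^ 'd) set) (d :: real).
        finite S \<and> A \<subseteq> (\<Union>g\<in>S. cell g) \<and>
        (\<forall>g\<in>S. bounded (cell g) \<and> diameter (cell g) \<le> d) \<and> 0 \<le> d \<and> d \<le> \<delta> \<and> card S * d ^ m \<le> B"
      using N by (intro exI[of _ S] exI[of _ cell] exI[of _ "2 * m / N"]) simp
  qed (use \<open>m > 0\<close> in auto)
  then show ?thesis using m_def by (simp add: order.strict_trans1)
qed

section \<open>From the outer measure to the surface measure of polyhedral boundaries\<close>

lemma sets_surface_measure_borel: "A \<in> sets borel \<Longrightarrow> A \<in> sets surface_measure"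
  by (auto simp: surface_measure_def intro!: sets_completionI_sets)

text \<open>\<open>measure_of\<close> yields the zero measure if its last argument is not a measure, so this holds
  whether or not the Hausdorff outer measure is countably additive on the Borel sets.\<close>

lemma emeasure_surface_measure_le:
  fixes A :: "(real ^ 'd::finite) set"
  assumes "A \<in> sets borel"
  shows "emeasure surface_measure A \<le> hausdorff_outer (CARD('d) - 1) A"
  using assms by (simp add: surface_measure_def emeasure_measure_of_conv)

text \<open>Compactness gives both the boundedness for the covering estimate and the Borel
  measurability for the comparison with the outer measure.\<close>

lemma surface_measure_compact_hyperplane:
  fixes A :: "(real ^ 'd::finite) set"
  assumes "compact A" "a \<noteq> 0" "A \<subseteq> {x. a \<bullet> x = b}" "CARD('d) \<ge> 2"
  shows "emeasure surface_measure A < \<infinity>"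
  using emeasure_surface_measure_le[of A] hausdorff_outer_bounded_hyperplane[of A a b] assms
  by (meson borel_compact compact_imp_bounded order.strict_trans1)

text \<open>A polytope with empty interior lies in a hyperplane and is its own frontier. Otherwise
  the frontier is the union of the finitely many facets, whose affine dimension is too small to
  leave a hyperplane.\<close>

lemma surface_measure_frontier_polytope:
  fixes K :: "(real ^ 'd::finite) set"
  assumes "polytope K" "CARD('d) \<ge> 2"
  shows "emeasure surface_measure (frontier K) < \<infinity>"
proof (cases "interior K = {}")
  case True
  then obtain a b where "a \<noteq> 0" "K \<subseteq> {x. a \<bullet> x = b}"
    using empty_interior_subset_hyperplane polytope_imp_convex[OF assms(1)] by metis
  moreover have "frontier K = K" "compact K"
    using True assms polytope_imp_compact polytope_imp_closed[OF assms(1)]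
    by (simp_all add: frontier_def closure_closed)
  ultimately show ?thesis using surface_measure_compact_hyperplane assms by metis
next
  case False
  have fin: "finite {F. F facet_of K}" by (rule finite_polytope_facets[OF assms(1)])
  have comp: "compact F" if "F facet_of K" for F
    using that assms(1) face_of_imp_compact polytope_imp_compact polytope_imp_convex
    by (auto simp: facet_of_def)
  have "emeasure surface_measure F < \<infinity>" if "F facet_of K" for F
  proof -
    have "aff_dim F < DIM(real ^ 'd)"
      using that aff_dim_le_DIM[of K] by (auto simp: facet_of_def)
    then obtain a b where "a \<noteq> 0" "F \<subseteq> {x. a \<bullet> x = b}" by (rule aff_lowdim_subset_hyperplane)
    then show ?thesis using surface_measure_compact_hyperplane comp that assms by metis
  qed
  moreover have "frontier K = \<Union>{F. F facet_of K}"
    using rel_frontier_of_polyhedron[OF polytope_imp_polyhedron[OF assms(1)]]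
      rel_frontier_nonempty_interior[OF False] by simp
  moreover have "emeasure surface_measure (\<Union>F\<in>{F. F facet_of K}. F)
      \<le> (\<Sum>F\<in>{F. F facet_of K}. emeasure surface_measure F)"
    using fin comp
    by (intro emeasure_subadditive_finite) (auto intro!: sets_surface_measure_borel borel_compact)
  moreover have "(\<Sum>F\<in>{F. F facet_of K}. emeasure surface_measure F) < \<infinity>"
    using fin calculation(1) by simp
  ultimately show ?thesis by (simp add: order.strict_trans1)
qed

text \<open>A frontier point lies in some polytope of the decomposition but in the interior of none,
  so finitely many polytope frontiers cover the frontier.\<close>

lemma surface_measure_frontier_polyhedral_domain:
  fixes \<Omega> :: "(real ^ 'd::finite) set"
  assumes "polyhedral_domain \<Omega>" "CARD('d) \<ge> 2"
  shows "emeasure surface_measure (frontier \<Omega>) < \<infinity>"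
proof -
  obtain P where P: "finite P" "\<And>K. K \<in> P \<Longrightarrow> polytope K" "closure \<Omega> = \<Union>P" "\<Omega> = interior (\<Union>P)"
    and "open \<Omega>"
    using assms(1) by (auto simp: polyhedral_domain_def)
  have "frontier \<Omega> \<subseteq> (\<Union>K\<in>P. frontier K)"
  proof
    fix x assume "x \<in> frontier \<Omega>"
    then have "x \<in> \<Union>P" "x \<notin> interior (\<Union>P)"
      using P \<open>open \<Omega>\<close> by (auto simp: frontier_def interior_open)
    moreover have "interior K \<subseteq> interior (\<Union>P)" if "K \<in> P" for K
      using that by (intro interior_mono) auto
    ultimately show "x \<in> (\<Union>K\<in>P. frontier K)"
      by (auto simp: frontier_def intro: closure_subset[THEN subsetD])
  qed
  then have "emeasure surface_measure (frontier \<Omega>) \<le> emeasure surface_measure (\<Union>K\<in>P. frontier K)"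
    using P(1) by (intro emeasure_mono) (auto intro!: sets_surface_measure_borel)
  also have "\<dots> \<le> (\<Sum>K\<in>P. emeasure surface_measure (frontier K))"
    using P(1) by (intro emeasure_subadditive_finite) (auto intro!: sets_surface_measure_borel)
  also have "\<dots> < \<infinity>"
    using P surface_measure_frontier_polytope[OF _ assms(2)] by simp
  finally show ?thesis .
qed

section \<open>Boundary traces of finite element functions\<close>

text \<open>Continuity on the compact closed cells bounds the function inside each of the finitely
  many cells. Nothing is known on the cell boundaries, but these are frontiers of convex sets and
  hence null sets.\<close>

lemma fe_space_AE_bounded:
  fixes \<Omega> :: "(real ^ 'd::finite) set" and v :: "real ^ 'd \<Rightarrow> 'b::real_normed_vector"
  assumes "open \<Omega>" and mesh: "mesh_of \<Omega> \<T>" and "fe_space \<T> S" and "v \<in> S"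
  shows "\<exists>C\<ge>0. AE x in lebesgue_on \<Omega>. norm (v x) \<le> C"
proof -
  have "\<exists>c. \<forall>x\<in>interior K. norm (v x) \<le> c" if "K \<in> \<T>" for K
  proof -
    have "\<exists>p. continuous_on K p \<and> (\<forall>x\<in>interior K. v x = p x)"
      using assms(3,4) that by (simp add: fe_space_def)
    then obtain p where p: "continuous_on K p" "\<And>x. x \<in> interior K \<Longrightarrow> v x = p x" by blast
    have "compact K" using mesh that by (simp add: mesh_of_def polytope_imp_compact)
    then have "bounded (p ` K)" by (intro compact_imp_bounded compact_continuous_image p(1))
    then obtain c where "norm (p x) \<le> c" if "x \<in> K" for x unfolding bounded_iff by blast
    then show ?thesis using p(2) interior_subset[of K] by (intro exI[of _ c]) (simp add: subset_eq)
  qed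
  then obtain c where c: "\<And>K x. K \<in> \<T> \<Longrightarrow> x \<in> interior K \<Longrightarrow> norm (v x) \<le> c K"
    using bchoice[of \<T> "\<lambda>K c. \<forall>x\<in>interior K. norm (v x) \<le> c"] by blast
  define C where "C = (\<Sum>K\<in>\<T>. \<bar>c K\<bar>)"
  have "finite \<T>" and un: "\<Union>\<T> = closure \<Omega>" using mesh by (auto simp: mesh_of_def)
  have C: "c K \<le> C" if "K \<in> \<T>" for K
    using member_le_sum[of K \<T> "\<lambda>K. \<bar>c K\<bar>"] that \<open>finite \<T>\<close> by (simp add: C_def)
  have "negligible (\<Union>K\<in>\<T>. frontier K)"
    using mesh \<open>finite \<T>\<close>
    by (intro negligible_Union) (auto simp: mesh_of_def polytope_imp_convex negligible_convex_frontier)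
  then have AE: "AE x in lebesgue. x \<notin> (\<Union>K\<in>\<T>. frontier K)"
    by (intro AE_not_in) (simp add: negligible_iff_null_sets)
  have bound: "norm (v x) \<le> C" if "x \<in> \<Omega>" "x \<notin> (\<Union>K\<in>\<T>. frontier K)" for x
  proof -
    have "x \<in> \<Union>\<T>" using that(1) closure_subset[of \<Omega>] by (simp add: un subsetD)
    then obtain K where K: "K \<in> \<T>" "x \<in> K" by blast
    then have "x \<in> interior K" using that(2) closure_subset[of K] by (auto simp: frontier_def)
    then show ?thesis using c[of K x] C[of K] K by linarith
  qed
  from AE have "AE x in lebesgue. x \<in> \<Omega> \<longrightarrow> norm (v x) \<le> C"
    by eventually_elim (use bound in blast)
  then have "AE x in lebesgue_on \<Omega>. norm (v x) \<le> C"
    using \<open>open \<Omega>\<close> by (subst AE_restrict_space_iff) auto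
  then show ?thesis by (intro exI[of _ C]) (auto simp: C_def sum_nonneg)
qed

text \<open>In contrast to \<open>has_trace_at\<close>, the limit value does not enter, so traces
  become limits of functions of \<open>x\<close> whose measurability is accessible.\<close>

definition ball_mean ::
    "(real ^ 'd::finite) set \<Rightarrow> (real ^ 'd \<Rightarrow> 'b::euclidean_space) \<Rightarrow> real ^ 'd \<Rightarrow> real \<Rightarrow> 'b" where
  "ball_mean \<Omega> v x r =
     integral\<^sup>L (lebesgue_on (\<Omega> \<inter> ball x r)) v /\<^sub>R measure lebesgue (\<Omega> \<inter> ball x r)"

lemma AE_bounded_integrable_on_ball:
  fixes v :: "real ^ 'd::finite \<Rightarrow> 'b::euclidean_space"
  assumes "open \<Omega>" and v: "v \<in> borel_measurable (lebesgue_on \<Omega>)"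
    and bnd: "AE y in lebesgue_on \<Omega>. norm (v y) \<le> C"
  shows "integrable (lebesgue_on (\<Omega> \<inter> ball x r)) v"
    and "AE y in lebesgue_on (\<Omega> \<inter> ball x r). norm (v y) \<le> C"
    and "finite_measure (lebesgue_on (\<Omega> \<inter> ball x r))"
proof -
  have "\<Omega> \<inter> ball x r \<in> lmeasurable"
    using \<open>open \<Omega>\<close> by (intro lmeasurable_open bounded_Int) auto
  then show fin: "finite_measure (lebesgue_on (\<Omega> \<inter> ball x r))" by (rule finite_measure_lebesgue_on)
  have "AE y in lebesgue. y \<in> \<Omega> \<longrightarrow> norm (v y) \<le> C"
    using bnd \<open>open \<Omega>\<close> by (subst (asm) AE_restrict_space_iff) auto
  then have "AE y in lebesgue. y \<in> \<Omega> \<inter> ball x r \<longrightarrow> norm (v y) \<le> C" by (auto elim: eventually_mono)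
  then show AE: "AE y in lebesgue_on (\<Omega> \<inter> ball x r). norm (v y) \<le> C"
    using \<open>open \<Omega>\<close> by (subst AE_restrict_space_iff) auto
  have "v \<in> borel_measurable (lebesgue_on (\<Omega> \<inter> ball x r))"
    using v by (rule measurable_restrict_mono) auto
  with AE show "integrable (lebesgue_on (\<Omega> \<inter> ball x r)) v"
    by (rule finite_measure.integrable_const_bound[OF fin])
qed

text \<open>Ensures that averages at boundary points do not divide by zero.\<close>

lemma measure_Int_ball_pos:
  fixes \<Omega> :: "(real ^ 'd::finite) set"
  assumes "open \<Omega>" "x \<in> closure \<Omega>" "r > 0"
  shows "measure lebesgue (\<Omega> \<inter> ball x r) > 0"
proof -
  have lm: "\<Omega> \<inter> ball x r \<in> lmeasurable"
    using \<open>open \<Omega>\<close> by (intro lmeasurable_open bounded_Int) auto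
  have "\<Omega> \<inter> ball x r \<noteq> {}"
    using assms(2,3) by (simp add: closure_approachable disjoint_iff) (metis dist_commute)
  then have "\<not> negligible (\<Omega> \<inter> ball x r)"
    using \<open>open \<Omega>\<close> by (intro open_not_negligible) auto
  then have "measure lebesgue (\<Omega> \<inter> ball x r) \<noteq> 0"
    using lm by (simp add: negligible_iff_measure)
  then show ?thesis by (simp add: zero_less_measure_iff)
qed

lemma norm_ball_mean_le:
  fixes v :: "real ^ 'd::finite \<Rightarrow> 'b::euclidean_space"
  assumes "open \<Omega>" "v \<in> borel_measurable (lebesgue_on \<Omega>)"
    and "AE y in lebesgue_on \<Omega>. norm (v y) \<le> C" and "x \<in> closure \<Omega>" "r > 0"
  shows "norm (ball_mean \<Omega> v x r) \<le> C"
proof -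
  let ?N = "lebesgue_on (\<Omega> \<inter> ball x r)" and ?m = "measure lebesgue (\<Omega> \<inter> ball x r)"
  note int = AE_bounded_integrable_on_ball[OF assms(1-3), of x r]
  have m: "?m > 0" by (rule measure_Int_ball_pos) fact+
  have "norm (integral\<^sup>L ?N v) \<le> integral\<^sup>L ?N (\<lambda>y. norm (v y))" by (rule integral_norm_bound)
  also have "\<dots> \<le> integral\<^sup>L ?N (\<lambda>y. C)"
    using int by (intro integral_mono_AE) (auto simp: finite_measure.integrable_const)
  also have "\<dots> = C * ?m" using \<open>open \<Omega>\<close> by (simp add: space_restrict_space measure_restrict_space)
  finally show ?thesis using m by (simp add: ball_mean_def field_simps)
qed

text \<open>The distance of the mean of \<open>v\<close> from \<open>a\<close> is at most the mean
  of \<open>norm (v y - a)\<close>, which tends to 0 by definition of the trace. In particular the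
  trace value is unique.\<close>

lemma has_trace_at_imp_ball_mean_tendsto:
  fixes v :: "real ^ 'd::finite \<Rightarrow> real ^ 'd"
  assumes "open \<Omega>" "v \<in> borel_measurable (lebesgue_on \<Omega>)"
    and "AE y in lebesgue_on \<Omega>. norm (v y) \<le> C" and "x \<in> closure \<Omega>" and "has_trace_at \<Omega> v x a"
  shows "(ball_mean \<Omega> v x \<longlongrightarrow> a) (at_right 0)"
proof -
  have "norm (ball_mean \<Omega> v x r - a)
      \<le> integral\<^sup>L (lebesgue_on (\<Omega> \<inter> ball x r)) (\<lambda>y. norm (v y - a)) / measure lebesgue (\<Omega> \<inter> ball x r)"
    if "r > 0" for r
  proof -
    let ?N = "lebesgue_on (\<Omega> \<inter> ball x r)" and ?m = "measure lebesgue (\<Omega> \<inter> ball x r)"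
    note int = AE_bounded_integrable_on_ball[OF assms(1-3), of x r]
    have m: "?m > 0" by (rule measure_Int_ball_pos) fact+
    have "integral\<^sup>L ?N (\<lambda>y. v y - a) = integral\<^sup>L ?N v - integral\<^sup>L ?N (\<lambda>y. a)"
      using int by (intro Bochner_Integration.integral_diff) (auto simp: finite_measure.integrable_const)
    also have "integral\<^sup>L ?N (\<lambda>y. a) = ?m *\<^sub>R a"
      using \<open>open \<Omega>\<close> by (simp add: space_restrict_space measure_restrict_space)
    finally have "ball_mean \<Omega> v x r - a = integral\<^sup>L ?N (\<lambda>y. v y - a) /\<^sub>R ?m"
      using m by (simp add: ball_mean_def scaleR_diff_right)
    then show ?thesis
      using integral_norm_bound[of ?N "\<lambda>y. v y - a"] m by (simp add: field_simps)
  qed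
  then have "eventually (\<lambda>r. norm (ball_mean \<Omega> v x r - a)
      \<le> integral\<^sup>L (lebesgue_on (\<Omega> \<inter> ball x r)) (\<lambda>y. norm (v y - a)) / measure lebesgue (\<Omega> \<inter> ball x r))
      (at_right 0)"
    by (rule eventually_mono[OF eventually_at_right_less])
  then have "((\<lambda>r. ball_mean \<Omega> v x r - a) \<longlongrightarrow> 0) (at_right 0)"
    using assms(5) unfolding has_trace_at_def by (rule Lim_null_comparison)
  then show ?thesis by (simp add: LIM_zero_iff)
qed

lemma btrace_has_trace_at: "has_trace_at \<Omega> v x a \<Longrightarrow> has_trace_at \<Omega> v x (btrace \<Omega> v x)"
  by (auto simp: btrace_def intro: someI)

text \<open>Means inherit the bound and pass it on to their limit. Where no trace exists,
  \<open>btrace\<close> has the default value 0, which is covered by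
  \<open>C \<ge> 0\<close>.\<close>

lemma norm_btrace_le:
  assumes "open \<Omega>" "v \<in> borel_measurable (lebesgue_on \<Omega>)"
    and "AE y in lebesgue_on \<Omega>. norm (v y) \<le> C" and "C \<ge> 0" and "x \<in> closure \<Omega>"
  shows "norm (btrace \<Omega> v x) \<le> C"
proof (cases "\<exists>a. has_trace_at \<Omega> v x a")
  case True
  then have "has_trace_at \<Omega> v x (btrace \<Omega> v x)" using btrace_has_trace_at by blast
  then have "(ball_mean \<Omega> v x \<longlongrightarrow> btrace \<Omega> v x) (at_right 0)"
    by (rule has_trace_at_imp_ball_mean_tendsto[OF assms(1-3,5)])
  moreover have "eventually (\<lambda>r. norm (ball_mean \<Omega> v x r) \<le> C) (at_right 0)"
    using norm_ball_mean_le[OF assms(1-3,5)]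
    by (rule eventually_mono[OF eventually_at_right_less[of "0::real"]])
  ultimately show ?thesis by (intro Lim_norm_ubound) auto
qed (simp add: btrace_def \<open>C \<ge> 0\<close>)

text \<open>The integral over a moving ball is a parameter integral over the fixed set
  \<open>\<Omega>\<close>, with the indicator of an open set of pairs as kernel. Joint measurability
  of the integrand then gives measurability in the centre.\<close>

lemma ball_mean_measurable:
  fixes \<Omega> :: "(real ^ 'd::finite) set" and v :: "real ^ 'd \<Rightarrow> 'b::euclidean_space"
  assumes "open \<Omega>" "bounded \<Omega>" and v [measurable]: "v \<in> borel_measurable (lebesgue_on \<Omega>)"
  shows "(\<lambda>x. ball_mean \<Omega> v x r) \<in> borel_measurable borel"
proof -
  interpret finite_measure "lebesgue_on \<Omega>"
    by (rule finite_measure_lebesgue_on) (use assms in \<open>auto intro: lmeasurable_open\<close>)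
  have int: "integral\<^sup>L (lebesgue_on (\<Omega> \<inter> ball x r)) w
      = integral\<^sup>L (lebesgue_on \<Omega>) (\<lambda>y. indicator {p. dist (fst p) (snd p) < r} (x, y) *\<^sub>R w y)"
    for x and w :: "real ^ 'd \<Rightarrow> 'c::euclidean_space"
  proof -
    have "lebesgue_on (\<Omega> \<inter> ball x r) = restrict_space (lebesgue_on \<Omega>) (ball x r)"
      using \<open>open \<Omega>\<close> by (subst restrict_restrict_space) auto
    moreover have "ball x r \<inter> space (lebesgue_on \<Omega>) \<in> sets (lebesgue_on \<Omega>)"
      using \<open>open \<Omega>\<close> by (auto simp: sets_restrict_space)
    ultimately have "integral\<^sup>L (lebesgue_on (\<Omega> \<inter> ball x r)) w
        = integral\<^sup>L (lebesgue_on \<Omega>) (\<lambda>y. indicator (ball x r) y *\<^sub>R w y)"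
      by (simp only: integral_restrict_space)
    then show ?thesis by (simp add: indicator_def)
  qed
  \<comment> \<open>The denominator is treated like the numerator, as the integral of the constant
    1.\<close>
  have m: "measure lebesgue (\<Omega> \<inter> ball x r) = integral\<^sup>L (lebesgue_on (\<Omega> \<inter> ball x r)) (\<lambda>y. 1)" for x
    using \<open>open \<Omega>\<close> by (simp add: space_restrict_space measure_restrict_space)
  have "open {p :: (real ^ 'd) \<times> (real ^ 'd). dist (fst p) (snd p) < r}"
    by (intro open_Collect_less continuous_intros)
  then have set: "{p :: (real ^ 'd) \<times> (real ^ 'd). dist (fst p) (snd p) < r} \<in> sets (borel \<Otimes>\<^sub>M borel)"
    unfolding borel_prod by (rule borel_open)
  \<comment> \<open>The second factor carries the Lebesgue sets, so the Borel set of pairs is pulled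
    back along the identity.\<close>
  have id: "(\<lambda>p. (fst p, snd p)) \<in> borel \<Otimes>\<^sub>M lebesgue_on \<Omega> \<rightarrow>\<^sub>M borel \<Otimes>\<^sub>M (borel :: (real ^ 'd) measure)"
    by (intro measurable_Pair measurable_fst)
      (auto intro!: measurable_compose[OF measurable_snd] measurable_restrict_space1 measurable_completion)
  have [measurable]: "(\<lambda>p. indicator {p. dist (fst p) (snd p) < r} p :: real)
      \<in> borel_measurable (borel \<Otimes>\<^sub>M lebesgue_on \<Omega>)"
    using measurable_compose[OF id borel_measurable_indicator[OF set]] by simp
  show ?thesis
    unfolding ball_mean_def m int by measurable
qed

text \<open>Preimages under \<open>f\<close> and \<open>g\<close> differ by a subset of a null set,
  which completeness makes measurable.\<close>

lemma (in complete_measure) borel_measurable_AE_eq: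
  assumes "f \<in> borel_measurable M" "AE x in M. f x = g x"
  shows "g \<in> borel_measurable M"
proof (rule measurableI)
  fix A :: "'b set" assume "A \<in> sets borel"
  show "g -` A \<inter> space M \<in> sets M"
  proof (rule in_sets_AE)
    show "f -` A \<inter> space M \<in> sets M" using assms(1) \<open>A \<in> sets borel\<close> by (rule measurable_sets)
    show "AE x in M. x \<in> f -` A \<inter> space M \<longleftrightarrow> x \<in> g -` A \<inter> space M"
      using assms(2) by eventually_elim auto
  qed auto
qed simp

text \<open>At almost every point of \<open>I\<close> the trace is a limit of ball means along a
  fixed sequence of radii, hence equal to a Borel function. Completeness of the surface measure
  absorbs the exceptional points.\<close>

lemma btrace_measurable:
  fixes v :: "real ^ 'd::finite \<Rightarrow> real ^ 'd"
  assumes "open \<Omega>" "bounded \<Omega>" and v: "v \<in> borel_measurable (lebesgue_on \<Omega>)"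
    and bnd: "AE y in lebesgue_on \<Omega>. norm (v y) \<le> C"
    and I: "I \<in> sets borel" "I \<subseteq> closure \<Omega>"
    and tr: "AE x in surface_measure. x \<in> I \<longrightarrow> (\<exists>a. has_trace_at \<Omega> v x a)"
  shows "btrace \<Omega> v \<in> borel_measurable (restrict_space surface_measure I)"
proof -
  \<comment> \<open>\<open>lim\<close> is a total operator, and it preserves Borel measurability
    even where the means diverge. The radii are positive from \<open>k = 0\<close> on.\<close>
  define g where "g x = indicator I x *\<^sub>R lim (\<lambda>k. ball_mean \<Omega> v x (1 / real (Suc k)))" for x
  have [measurable]: "(\<lambda>x. ball_mean \<Omega> v x r) \<in> borel_measurable borel" for r
    by (rule ball_mean_measurable) fact+
  have [measurable]: "I \<in> sets borel" by fact
  have "g \<in> borel_measurable borel" unfolding g_def by measurable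
  then have "g \<in> borel_measurable surface_measure"
    unfolding surface_measure_def by (intro measurable_completion) (simp add: measurable_def)
  moreover have "AE x in surface_measure. g x = indicator I x *\<^sub>R btrace \<Omega> v x"
    using tr
  proof eventually_elim
    case (elim x)
    show ?case
    proof (cases "x \<in> I")
      case True
      then have "has_trace_at \<Omega> v x (btrace \<Omega> v x)" using elim btrace_has_trace_at by blast
      then have "(ball_mean \<Omega> v x \<longlongrightarrow> btrace \<Omega> v x) (at_right 0)"
        using has_trace_at_imp_ball_mean_tendsto[OF assms(1) v bnd] True I by blast
      moreover have "filterlim (\<lambda>k. 1 / real (Suc k)) (at_right 0) sequentially"
        unfolding filterlim_at using LIMSEQ_Suc[OF lim_1_over_n] by simp
      ultimately have "(\<lambda>k. ball_mean \<Omega> v x (1 / real (Suc k))) \<longlonglongrightarrow> btrace \<Omega> v x"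
        by (rule filterlim_compose)
      then show ?thesis by (simp add: g_def limI)
    qed (simp add: g_def)
  qed
  ultimately have "(\<lambda>x. indicator I x *\<^sub>R btrace \<Omega> v x) \<in> borel_measurable surface_measure"
    unfolding surface_measure_def by (rule completion.borel_measurable_AE_eq)
  then show ?thesis
    using sets_surface_measure_borel[OF I(1)] by (subst borel_measurable_restrict_space_iff) auto
qed

section \<open>Energy balance of one step\<close>

text \<open>Stated for arbitrary measures, so that volume and interface integrals share one
  polarization identity.\<close>

definition square_integrable :: "'a measure \<Rightarrow> ('a \<Rightarrow> 'b::euclidean_space) set" where
  "square_integrable M = {f \<in> borel_measurable M. integrable M (\<lambda>x. (norm (f x))\<^sup>2)}"

lemma L2_eq_square_integrable: "L2 \<Omega> = square_integrable (lebesgue_on \<Omega>)"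
  by (auto simp: L2_def square_integrable_def)

lemma integrable_inner_square_integrable:
  assumes "f \<in> square_integrable M" "g \<in> square_integrable M"
  shows "integrable M (\<lambda>x. f x \<bullet> g x)"
proof (rule Bochner_Integration.integrable_bound)
  show "integrable M (\<lambda>x. (norm (f x))\<^sup>2 + (norm (g x))\<^sup>2)"
    and "(\<lambda>x. f x \<bullet> g x) \<in> borel_measurable M"
    using assms by (auto simp: square_integrable_def)
  have "\<bar>f x \<bullet> g x\<bar> \<le> (norm (f x))\<^sup>2 + (norm (g x))\<^sup>2" for x
    using Cauchy_Schwarz_ineq2[of "f x" "g x"] sum_squares_bound[of "norm (f x)" "norm (g x)"]
      zero_le_mult_iff[of "norm (f x)" "norm (g x)"] by simp
  then show "AE x in M. norm (f x \<bullet> g x) \<le> norm ((norm (f x))\<^sup>2 + (norm (g x))\<^sup>2)"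
    by simp
qed

lemma integral_polarization:
  assumes "f \<in> square_integrable M" "g \<in> square_integrable M"
  shows "(\<integral>x. (norm (f x - g x))\<^sup>2 \<partial>M)
    = (\<integral>x. (norm (f x))\<^sup>2 \<partial>M) - 2 * (\<integral>x. f x \<bullet> g x \<partial>M) + (\<integral>x. (norm (g x))\<^sup>2 \<partial>M)"
proof -
  have "(\<lambda>x. (norm (f x - g x))\<^sup>2) = (\<lambda>x. (norm (f x))\<^sup>2 - 2 * (f x \<bullet> g x) + (norm (g x))\<^sup>2)"
    by (simp add: power2_norm_eq_inner inner_diff inner_commute algebra_simps)
  then show ?thesis
    using assms integrable_inner_square_integrable[OF assms] by (simp add: square_integrable_def)
qed

lemma two_integral_inner_le:
  assumes "f \<in> square_integrable M" "g \<in> square_integrable M"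
  shows "2 * (\<integral>x. f x \<bullet> g x \<partial>M) \<le> (\<integral>x. (norm (f x))\<^sup>2 \<partial>M) + (\<integral>x. (norm (g x))\<^sup>2 \<partial>M)"
  using integral_polarization[OF assms] Bochner_Integration.integral_nonneg[of M "\<lambda>x. (norm (f x - g x))\<^sup>2"]
  by simp

lemma (in finite_measure) bounded_imp_square_integrable:
  assumes [measurable]: "f \<in> borel_measurable M" and "\<And>x. x \<in> space M \<Longrightarrow> norm (f x) \<le> B"
  shows "f \<in> square_integrable M"
proof -
  have "integrable M (\<lambda>x. (norm (f x))\<^sup>2)"
  proof (rule integrable_const_bound)
    show "AE x in M. norm ((norm (f x))\<^sup>2) \<le> B\<^sup>2"
      using assms(2) by (intro AE_I2) (simp add: power_mono)
  qed measurable
  then show ?thesis by (simp add: square_integrable_def)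
qed

section \<open>Polarization estimates in \<open>L2\<close>\<close>

lemma L2_norm_power2: "(L2_norm \<Omega> v)\<^sup>2 = (\<integral>x. (norm (v x))\<^sup>2 \<partial>lebesgue_on \<Omega>)"
  by (simp add: L2_norm_def L2_inner_def power2_norm_eq_inner)

text \<open>The two sides differ by the squared norm of \<open>v - w\<close>, which is dropped.
  Applied to successive velocities, this treats the time difference.\<close>

lemma L2_inner_diff_polarization:
  assumes "v \<in> L2 \<Omega>" "w \<in> L2 \<Omega>"
  shows "(L2_norm \<Omega> v)\<^sup>2 - (L2_norm \<Omega> w)\<^sup>2 \<le> 2 * L2_inner \<Omega> (\<lambda>x. v x - w x) v"
proof -
  have "L2_inner \<Omega> (\<lambda>x. v x - w x) v = (L2_norm \<Omega> v)\<^sup>2 - L2_inner \<Omega> w v"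
    using assms
    by (simp add: L2_inner_def L2_norm_power2 L2_eq_square_integrable inner_diff_left
        integrable_inner_square_integrable power2_norm_eq_inner)
  moreover have "2 * L2_inner \<Omega> w v \<le> (L2_norm \<Omega> w)\<^sup>2 + (L2_norm \<Omega> v)\<^sup>2"
    using two_integral_inner_le assms by (simp add: L2_norm_power2 L2_inner_def L2_eq_square_integrable)
  ultimately show ?thesis by linarith
qed

lemma L2_norm_projection_le:
  assumes "g \<in> L2 \<Omega>" "w \<in> L2 \<Omega>" and "L2_inner \<Omega> (\<lambda>x. g x - w x) g = 0"
  shows "(L2_norm \<Omega> g)\<^sup>2 \<le> (L2_norm \<Omega> w)\<^sup>2"
  using L2_inner_diff_polarization[OF assms(1,2)] assms(3) by simp

lemma grad_in_L2:
  assumes "v \<in> H1 \<Omega>"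
  shows "grad \<Omega> v \<in> L2 \<Omega>"
proof -
  have "\<exists>G. is_weak_grad \<Omega> v G" using assms by (simp add: H1_def)
  then have "is_weak_grad \<Omega> v (grad \<Omega> v)" unfolding grad_def by (rule someI_ex)
  then show ?thesis by (simp add: is_weak_grad_def)
qed

text \<open>The interface terms are carried along exactly, without estimating them, which matters
  because \<open>\<kappa>\<close> may be negative. The inequality comes only from the time
  difference, the eddy viscosity and the force.\<close>

lemma gavms_step_energy:
  fixes u :: "nat \<Rightarrow> nat \<Rightarrow> real ^ 'd::finite \<Rightarrow> real ^ 'd"
  assumes step: "gavms_step \<Omega> I Vh LH \<nu> \<nu>T \<kappa> dt f u G n i j"
    and H1: "u i n \<in> H1 (\<Omega> i)" "u i (n + 1) \<in> H1 (\<Omega> i)"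
    and LH: "LH i \<subseteq> L2 (\<Omega> i)"
    and par: "\<nu> i > 0" "\<nu>T \<ge> 0" "dt > 0"
    and f: "f i (real (n + 1) * dt) \<in> Hm1_acting_on (\<Omega> i) (Vh i)"
  shows "(L2_norm (\<Omega> i) (u i (n + 1)))\<^sup>2 - (L2_norm (\<Omega> i) (u i n))\<^sup>2
      + \<nu> i * dt * (L2_norm (\<Omega> i) (grad (\<Omega> i) (u i (n + 1))))\<^sup>2
      + \<nu>T * dt * ((L2_norm (\<Omega> i) (grad (\<Omega> i) (u i (n + 1))))\<^sup>2
                   - (L2_norm (\<Omega> i) (grad (\<Omega> i) (u i n)))\<^sup>2)
      + \<kappa> * dt * (2 * (surface_integral I (\<lambda>x. jump_norm \<Omega> u n x *
              (btrace (\<Omega> i) (u i (n + 1)) x \<bullet> btrace (\<Omega> i) (u i (n + 1)) x))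
        - surface_integral I (\<lambda>x. sqrt (jump_norm \<Omega> u n x) * sqrt (jump_norm \<Omega> u (n - 1) x) *
              (btrace (\<Omega> j) (u j n) x \<bullet> btrace (\<Omega> i) (u i (n + 1)) x))))
    \<le> dt * (inverse (\<nu> i) * (Hm1_norm (\<Omega> i) (f i (real (n + 1) * dt)))\<^sup>2)"
proof -
  let ?v = "u i (n + 1)" and ?w = "u i n" and ?F = "f i (real (n + 1) * dt)" and ?\<Omega> = "\<Omega> i"
  let ?gv = "L2_norm ?\<Omega> (grad ?\<Omega> ?v)" and ?gw = "L2_norm ?\<Omega> (grad ?\<Omega> ?w)"
  define P where "P = surface_integral I (\<lambda>x. jump_norm \<Omega> u n x * (btrace ?\<Omega> ?v x \<bullet> btrace ?\<Omega> ?v x))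
    - surface_integral I (\<lambda>x. sqrt (jump_norm \<Omega> u n x) * sqrt (jump_norm \<Omega> u (n - 1) x) *
        (btrace (\<Omega> j) (u j n) x \<bullet> btrace ?\<Omega> ?v x))"
  have v: "?v \<in> Vh i" "G i n \<in> LH i" using step by (simp_all add: gavms_step_def)
  have L2: "?v \<in> L2 ?\<Omega>" "?w \<in> L2 ?\<Omega>" "grad ?\<Omega> ?v \<in> L2 ?\<Omega>" "grad ?\<Omega> ?w \<in> L2 ?\<Omega>" "G i n \<in> L2 ?\<Omega>"
    using H1 LH v grad_in_L2 by (auto simp: H1_def)
  have "L2_inner ?\<Omega> (\<lambda>x. (?v x - ?w x) /\<^sub>R dt) ?v + (\<nu> i + \<nu>T) * L2_inner ?\<Omega> (grad ?\<Omega> ?v) (grad ?\<Omega> ?v)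
      + trilinear ?\<Omega> ?v ?v ?v + \<kappa> * P = ?F ?v + \<nu>T * L2_inner ?\<Omega> (G i n) (grad ?\<Omega> ?v)"
    using step[unfolded gavms_step_def, THEN conjunct2, THEN conjunct2, THEN conjunct1,
        THEN bspec, OF v(1)]
    by (simp only: P_def right_diff_distrib add_diff_eq)
  \<comment> \<open>The two halves of the skew-symmetrized form coincide when its last two arguments
    do.\<close>
  moreover have "trilinear ?\<Omega> ?v ?v ?v = 0" by (simp add: trilinear_def)
  moreover have "L2_inner ?\<Omega> (\<lambda>x. (?v x - ?w x) /\<^sub>R dt) ?v = L2_inner ?\<Omega> (\<lambda>x. ?v x - ?w x) ?v / dt"
    by (simp add: L2_inner_def divide_inverse mult.commute)
  moreover have "L2_inner ?\<Omega> (grad ?\<Omega> ?v) (grad ?\<Omega> ?v) = ?gv\<^sup>2"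
    by (simp add: L2_norm_power2 L2_inner_def power2_norm_eq_inner)
  ultimately have "L2_inner ?\<Omega> (\<lambda>x. ?v x - ?w x) ?v / dt + (\<nu> i + \<nu>T) * ?gv\<^sup>2 + \<kappa> * P
      = ?F ?v + \<nu>T * L2_inner ?\<Omega> (G i n) (grad ?\<Omega> ?v)" by simp
  \<comment> \<open>After multiplication by \<open>2 * dt\<close>, one of the two copies of each
    gradient term pays for the force or for the projected gradient, and the other remains on the
    left.\<close>
  then have "dt * (L2_inner ?\<Omega> (\<lambda>x. ?v x - ?w x) ?v / dt + (\<nu> i + \<nu>T) * ?gv\<^sup>2 + \<kappa> * P)
      = dt * (?F ?v + \<nu>T * L2_inner ?\<Omega> (G i n) (grad ?\<Omega> ?v))" by simp
  then have eq: "2 * L2_inner ?\<Omega> (\<lambda>x. ?v x - ?w x) ?v + 2 * (\<nu> i * dt * ?gv\<^sup>2) + 2 * (\<nu>T * dt * ?gv\<^sup>2)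
      + \<kappa> * dt * (2 * P) = dt * (2 * ?F ?v) + \<nu>T * dt * (2 * L2_inner ?\<Omega> (G i n) (grad ?\<Omega> ?v))"
    using par by (simp add: algebra_simps)
  \<comment> \<open>The projection equation is tested with \<open>G i n\<close> itself.\<close>
  have "(L2_norm ?\<Omega> (G i n))\<^sup>2 \<le> ?gw\<^sup>2"
    using step v by (intro L2_norm_projection_le L2) (simp add: gavms_step_def)
  moreover have "2 * L2_inner ?\<Omega> (G i n) (grad ?\<Omega> ?v) \<le> (L2_norm ?\<Omega> (G i n))\<^sup>2 + ?gv\<^sup>2"
    using two_integral_inner_le L2 by (simp add: L2_norm_power2 L2_inner_def L2_eq_square_integrable)
  ultimately have "2 * L2_inner ?\<Omega> (G i n) (grad ?\<Omega> ?v) \<le> ?gw\<^sup>2 + ?gv\<^sup>2" by linarith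
  then have G: "\<nu>T * dt * (2 * L2_inner ?\<Omega> (G i n) (grad ?\<Omega> ?v)) \<le> \<nu>T * dt * (?gw\<^sup>2 + ?gv\<^sup>2)"
    using par by (intro mult_left_mono) auto
  \<comment> \<open>The test field need not lie in \<open>H10\<close>; the dual estimate is the
    bound on the test space built into \<open>Hm1_acting_on\<close>.\<close>
  have "2 * ?F ?v \<le> 2 * (Hm1_norm ?\<Omega> ?F * ?gv)"
    using f v by (force simp: Hm1_acting_on_def)
  \<comment> \<open>Young's inequality, weighted so that exactly one viscous term is
    absorbed.\<close>
  also have "\<dots> \<le> inverse (\<nu> i) * (Hm1_norm ?\<Omega> ?F)\<^sup>2 + \<nu> i * ?gv\<^sup>2"
  proof -
    have "0 \<le> inverse (\<nu> i) * (Hm1_norm ?\<Omega> ?F - \<nu> i * ?gv)\<^sup>2" using par by simp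
    also have "\<dots> = inverse (\<nu> i) * (Hm1_norm ?\<Omega> ?F)\<^sup>2 + \<nu> i * ?gv\<^sup>2 - 2 * (Hm1_norm ?\<Omega> ?F * ?gv)"
      using par by (simp add: power2_eq_square field_simps)
    finally show ?thesis by simp
  qed
  finally have "dt * (2 * ?F ?v) \<le> dt * (inverse (\<nu> i) * (Hm1_norm ?\<Omega> ?F)\<^sup>2 + \<nu> i * ?gv\<^sup>2)"
    using par by (intro mult_left_mono) auto
  with eq G L2_inner_diff_polarization[OF L2(1,2)]
  have "(L2_norm ?\<Omega> ?v)\<^sup>2 - (L2_norm ?\<Omega> ?w)\<^sup>2 + \<nu> i * dt * ?gv\<^sup>2
      + \<nu>T * dt * (?gv\<^sup>2 - ?gw\<^sup>2) + \<kappa> * dt * (2 * P) \<le> dt * (inverse (\<nu> i) * (Hm1_norm ?\<Omega> ?F)\<^sup>2)"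
    by (simp add: algebra_simps)
  then show ?thesis unfolding P_def .
qed

section \<open>Interface integrals\<close>

lemma surface_integral_eq:
  "I \<in> sets borel \<Longrightarrow> surface_integral I g = integral\<^sup>L (restrict_space surface_measure I) g"
  using sets_surface_measure_borel[of I]
  by (simp add: surface_integral_def set_lebesgue_integral_def integral_restrict_space)

text \<open>Boundedness survives multiplication by the weights
  \<open>sqrt (jump_norm \<Omega> u n x)\<close>, which square integrability alone would not. On a
  set of finite measure it implies square integrability.\<close>

definition bounded_on_interface :: "(real ^ 'd::finite) set \<Rightarrow> (real ^ 'd \<Rightarrow> 'b::euclidean_space) \<Rightarrow> bool" where
  "bounded_on_interface I g \<longleftrightarrow>
     g \<in> borel_measurable (restrict_space surface_measure I) \<and> (\<exists>B. \<forall>x\<in>I. norm (g x) \<le> B)"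

lemma bounded_on_interface_square_integrable:
  assumes "I \<in> sets borel" "emeasure surface_measure I < \<infinity>" "bounded_on_interface I g"
  shows "g \<in> square_integrable (restrict_space surface_measure I)"
proof -
  have I: "I \<inter> space surface_measure \<in> sets surface_measure"
    using sets_surface_measure_borel[OF assms(1)] by auto
  interpret finite_measure "restrict_space surface_measure I"
    using assms(2) I sets_surface_measure_borel[OF assms(1), THEN sets.sets_into_space]
    by (intro finite_measureI) (auto simp: emeasure_restrict_space space_restrict_space Int_absorb2)
  obtain B where "\<And>x. x \<in> I \<Longrightarrow> norm (g x) \<le> B" using assms(3) by (auto simp: bounded_on_interface_def)
  then show ?thesis
    using assms(3)
    by (intro bounded_imp_square_integrable[of g B]) (auto simp: bounded_on_interface_def space_restrict_space)
qed

lemma bounded_on_interface_btrace: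
  fixes \<Omega> :: "(real ^ 'd::finite) set"
  assumes "polyhedral_domain \<Omega>" "conforming_fe_pair \<Omega> I \<T> Xh Qh" "v \<in> Xh"
    and I: "I \<in> sets borel" "I \<subseteq> frontier \<Omega>"
  shows "bounded_on_interface I (btrace \<Omega> v)"
proof -
  have "open \<Omega>" using assms(1) by (simp add: polyhedral_domain_def)
  have mesh: "mesh_of \<Omega> \<T>" "fe_space \<T> Xh" and X: "v \<in> X_space \<Omega> I"
    using assms(2,3) by (auto simp: conforming_fe_pair_def)
  \<comment> \<open>The closure is a finite union of polytopes, the cells of the mesh.\<close>
  have "compact (closure \<Omega>)"
    using mesh by (metis compact_Union mesh_of_def polytope_imp_compact)
  then have "bounded \<Omega>" using bounded_subset[OF compact_imp_bounded closure_subset] by blast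
  have I_cl: "I \<subseteq> closure \<Omega>" using I(2) by (auto simp: frontier_def)
  obtain C where C: "C \<ge> 0" "AE x in lebesgue_on \<Omega>. norm (v x) \<le> C"
    using fe_space_AE_bounded[OF \<open>open \<Omega>\<close> mesh assms(3)] by blast
  have v: "v \<in> borel_measurable (lebesgue_on \<Omega>)" using X by (simp add: X_space_def H1_def L2_def)
  have "AE x in surface_measure. x \<in> I \<longrightarrow>
      (\<exists>a. has_trace_at \<Omega> v x a \<and> (\<forall>n. outer_normal \<Omega> x n \<longrightarrow> a \<bullet> n = 0))"
    using X by (simp add: X_space_def)
  then have "AE x in surface_measure. x \<in> I \<longrightarrow> (\<exists>a. has_trace_at \<Omega> v x a)"
    by eventually_elim blast
  then have "btrace \<Omega> v \<in> borel_measurable (restrict_space surface_measure I)"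
    by (intro btrace_measurable[OF \<open>open \<Omega>\<close> \<open>bounded \<Omega>\<close> v C(2) I(1) I_cl])
  moreover have "norm (btrace \<Omega> v x) \<le> C" if "x \<in> I" for x
    using norm_btrace_le[OF \<open>open \<Omega>\<close> v C(2,1)] I_cl that by blast
  ultimately show ?thesis unfolding bounded_on_interface_def by blast
qed

lemma bounded_on_interface_sqrt_jump:
  fixes w :: "real ^ 'd::finite \<Rightarrow> real ^ 'd"
  assumes "bounded_on_interface I (btrace (\<Omega> 1) (u 1 n))" "bounded_on_interface I (btrace (\<Omega> 2) (u 2 n))"
    and "bounded_on_interface I w"
  shows "bounded_on_interface I (\<lambda>x. sqrt (jump_norm \<Omega> u n x) *\<^sub>R w x)"
proof -
  obtain B1 B2 B where B: "\<And>x. x \<in> I \<Longrightarrow> norm (btrace (\<Omega> 1) (u 1 n) x) \<le> B1"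
      "\<And>x. x \<in> I \<Longrightarrow> norm (btrace (\<Omega> 2) (u 2 n) x) \<le> B2" "\<And>x. x \<in> I \<Longrightarrow> norm (w x) \<le> B"
    using assms unfolding bounded_on_interface_def by metis
  have [measurable]: "btrace (\<Omega> 1) (u 1 n) \<in> borel_measurable (restrict_space surface_measure I)"
      "btrace (\<Omega> 2) (u 2 n) \<in> borel_measurable (restrict_space surface_measure I)"
      "w \<in> borel_measurable (restrict_space surface_measure I)"
    using assms by (simp_all add: bounded_on_interface_def)
  have "(\<lambda>x. sqrt (jump_norm \<Omega> u n x) *\<^sub>R w x) \<in> borel_measurable (restrict_space surface_measure I)"
    unfolding jump_norm_def by measurable
  moreover have "norm (sqrt (jump_norm \<Omega> u n x) *\<^sub>R w x) \<le> sqrt (B1 + B2) * B" if "x \<in> I" for x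
  proof -
    have "jump_norm \<Omega> u n x \<le> B1 + B2"
      unfolding jump_norm_def using B(1,2)[OF that] norm_triangle_ineq4 by (meson add_mono order.trans)
    moreover have "0 \<le> jump_norm \<Omega> u n x" by (simp add: jump_norm_def)
    ultimately show ?thesis using B(3)[OF that] by (auto intro!: mult_mono)
  qed
  ultimately show ?thesis unfolding bounded_on_interface_def by blast
qed

section \<open>Telescoping in time and interface identities\<close>

lemma telescoping_inequality:
  fixes E d r :: "nat \<Rightarrow> real"
  assumes "\<And>n. n \<in> {1..M} \<Longrightarrow> E (n + 1) + d n \<le> E n + r n"
  shows "E (M + 1) + (\<Sum>n=1..M. d n) \<le> E 1 + (\<Sum>n=1..M. r n)"
  using assms
proof (induction M)
  case (Suc M)
  have "E (M + 1) + (\<Sum>n=1..M. d n) \<le> E 1 + (\<Sum>n=1..M. r n)"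
    using Suc.prems by (intro Suc.IH) simp
  moreover have "E (Suc M + 1) + d (Suc M) \<le> E (M + 1) + r (Suc M)"
    using Suc.prems[of "Suc M"] by simp
  ultimately show ?case by simp
qed simp

text \<open>Polarization of \<open>sqrt (a x) *\<^sub>R v x\<close> and
  \<open>sqrt (b x) *\<^sub>R w x\<close>. Giving each velocity its own weight is what makes the
  negative square the positive one of the preceding time level.\<close>

lemma interface_polarization:
  assumes I: "I \<in> sets borel" "emeasure surface_measure I < \<infinity>"
    and p: "bounded_on_interface I (\<lambda>x. sqrt (a x) *\<^sub>R v x)"
    and q: "bounded_on_interface I (\<lambda>x. sqrt (b x) *\<^sub>R w x)"
    and nonneg: "\<And>x. a x \<ge> 0" "\<And>x. b x \<ge> 0"
  shows "2 * (surface_integral I (\<lambda>x. a x * (v x \<bullet> v x))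
      - surface_integral I (\<lambda>x. sqrt (a x) * sqrt (b x) * (w x \<bullet> v x)))
    = surface_integral I (\<lambda>x. a x * (norm (v x))\<^sup>2) - surface_integral I (\<lambda>x. b x * (norm (w x))\<^sup>2)
      + surface_integral I (\<lambda>x. (norm (sqrt (a x) *\<^sub>R v x - sqrt (b x) *\<^sub>R w x))\<^sup>2)"
proof -
  note sq = bounded_on_interface_square_integrable[OF I p] bounded_on_interface_square_integrable[OF I q]
  have weight: "(norm (sqrt (a x) *\<^sub>R v x))\<^sup>2 = a x * (norm (v x))\<^sup>2"
    "(norm (sqrt (b x) *\<^sub>R w x))\<^sup>2 = b x * (norm (w x))\<^sup>2"
    "(sqrt (a x) *\<^sub>R v x) \<bullet> (sqrt (b x) *\<^sub>R w x) = sqrt (a x) * sqrt (b x) * (w x \<bullet> v x)" for x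
    using nonneg by (simp_all add: power_mult_distrib inner_commute)
  \<comment> \<open>The scaled vectors must stay intact until \<open>weight\<close> rewrites them,
    hence the deleted simplification rules.\<close>
  show ?thesis
    using integral_polarization[OF sq]
    by (simp add: surface_integral_eq[OF I(1)] dot_square_norm weight
        del: norm_scaleR inner_scaleR_left inner_scaleR_right)
qed

text \<open>Additivity requires both summands to be integrable, and these are the squared norms of
  the bounded weighted traces.\<close>

lemma surface_integral_distrib_add:
  fixes v w :: "real ^ 'd::finite \<Rightarrow> 'b::euclidean_space"
  assumes I: "I \<in> sets borel" "emeasure surface_measure I < \<infinity>"
    and p: "bounded_on_interface I (\<lambda>x. sqrt (a x) *\<^sub>R v x)"
    and q: "bounded_on_interface I (\<lambda>x. sqrt (a x) *\<^sub>R w x)"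
    and nonneg: "\<And>x. a x \<ge> 0"
  shows "surface_integral I (\<lambda>x. a x * ((norm (v x))\<^sup>2 + (norm (w x))\<^sup>2))
    = surface_integral I (\<lambda>x. a x * (norm (v x))\<^sup>2) + surface_integral I (\<lambda>x. a x * (norm (w x))\<^sup>2)"
proof -
  have weight: "(norm (sqrt (a x) *\<^sub>R z))\<^sup>2 = a x * (norm z)\<^sup>2" for x and z :: 'b
    using nonneg by (simp add: power_mult_distrib)
  have "integrable (restrict_space surface_measure I) (\<lambda>x. a x * (norm (v x))\<^sup>2)"
    "integrable (restrict_space surface_measure I) (\<lambda>x. a x * (norm (w x))\<^sup>2)"
    using bounded_on_interface_square_integrable[OF I p] bounded_on_interface_square_integrable[OF I q]
    by (simp_all add: square_integrable_def weight del: norm_scaleR)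
  then show ?thesis by (simp add: surface_integral_eq[OF I(1)] distrib_left)
qed

theorem lemma4p2:
  fixes D I :: "(real ^ 'd::finite) set"
    and \<Omega> :: "nat \<Rightarrow> (real ^ 'd) set"
    and \<T> :: "nat \<Rightarrow> (real ^ 'd) set set"
    and Xh :: "nat \<Rightarrow> (real ^ 'd \<Rightarrow> real ^ 'd) set"
    and Qh :: "nat \<Rightarrow> (real ^ 'd \<Rightarrow> real) set"
    and Vh :: "nat \<Rightarrow> (real ^ 'd \<Rightarrow> real ^ 'd) set"
    and LH :: "nat \<Rightarrow> (real ^ 'd \<Rightarrow> real ^ 'd ^ 'd) set"
    and \<nu> :: "nat \<Rightarrow> real" and \<nu>T \<kappa> dt T :: real
    and f :: "nat \<Rightarrow> real \<Rightarrow> (real ^ 'd \<Rightarrow> real ^ 'd) \<Rightarrow> real"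
    and u :: "nat \<Rightarrow> nat \<Rightarrow> real ^ 'd \<Rightarrow> real ^ 'd"
    and G :: "nat \<Rightarrow> nat \<Rightarrow> real ^ 'd \<Rightarrow> real ^ 'd ^ 'd"
    and M :: nat
  assumes dim: "CARD('d) \<in> {2, 3}"
    and dom: "coupled_domains D \<Omega> I"
    and fem: "\<And>i. i \<in> {1, 2} \<Longrightarrow> conforming_fe_pair (\<Omega> i) I (\<T> i) (Xh i) (Qh i)"
    and Vh: "\<And>i. i \<in> {1, 2} \<Longrightarrow> Vh i = V_space (\<Omega> i) (Xh i) (Qh i)"
    and LH: "\<And>i. i \<in> {1, 2} \<Longrightarrow> fin_dim_space (LH i) \<and> LH i \<subseteq> L2 (\<Omega> i)"
    and \<nu>: "\<nu> 1 > 0" "\<nu> 2 > 0"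
    and \<nu>T: "\<nu>T \<ge> 0"
    and dt: "dt > 0"
    and T: "T > 0"
    and f: "\<And>i. i \<in> {1, 2} \<Longrightarrow> f i \<in> L2_time_Hm1 T (\<Omega> i)"
    and f_levels: "\<And>i n. i \<in> {1, 2} \<Longrightarrow> n \<in> {1..M} \<Longrightarrow>
                     f i (real (n + 1) * dt) \<in> Hm1_acting_on (\<Omega> i) (Vh i)"
    and scheme: "gavms_solution \<Omega> I Vh LH \<nu> \<nu>T \<kappa> dt f u G M"
  shows "(L2_norm (\<Omega> 1) (u 1 (M + 1)))\<^sup>2 + (L2_norm (\<Omega> 2) (u 2 (M + 1)))\<^sup>2
      + \<nu>T * dt * ((L2_norm (\<Omega> 1) (grad (\<Omega> 1) (u 1 (M + 1))))\<^sup>2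
                   + (L2_norm (\<Omega> 2) (grad (\<Omega> 2) (u 2 (M + 1))))\<^sup>2)
      + \<nu> 1 * dt * (\<Sum>n=1..M. (L2_norm (\<Omega> 1) (grad (\<Omega> 1) (u 1 (n + 1))))\<^sup>2)
      + \<nu> 2 * dt * (\<Sum>n=1..M. (L2_norm (\<Omega> 2) (grad (\<Omega> 2) (u 2 (n + 1))))\<^sup>2)
      + \<kappa> * dt * surface_integral I (\<lambda>x. jump_norm \<Omega> u M x *
            ((norm (btrace (\<Omega> 1) (u 1 (M + 1)) x))\<^sup>2 + (norm (btrace (\<Omega> 2) (u 2 (M + 1)) x))\<^sup>2))
      + \<kappa> * dt * (\<Sum>n=1..M. surface_integral I (\<lambda>x.
            (norm (sqrt (jump_norm \<Omega> u n x) *\<^sub>R btrace (\<Omega> 1) (u 1 (n + 1)) x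
                   - sqrt (jump_norm \<Omega> u (n - 1) x) *\<^sub>R btrace (\<Omega> 2) (u 2 n) x))\<^sup>2))
      + \<kappa> * dt * (\<Sum>n=1..M. surface_integral I (\<lambda>x.
            (norm (sqrt (jump_norm \<Omega> u n x) *\<^sub>R btrace (\<Omega> 2) (u 2 (n + 1)) x
                   - sqrt (jump_norm \<Omega> u (n - 1) x) *\<^sub>R btrace (\<Omega> 1) (u 1 n) x))\<^sup>2))
    \<le> (L2_norm (\<Omega> 1) (u 1 1))\<^sup>2 + (L2_norm (\<Omega> 2) (u 2 1))\<^sup>2
      + \<kappa> * dt * surface_integral I (\<lambda>x. jump_norm \<Omega> u 0 x *
            ((norm (btrace (\<Omega> 1) (u 1 1) x))\<^sup>2 + (norm (btrace (\<Omega> 2) (u 2 1) x))\<^sup>2))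
      + \<nu>T * dt * ((L2_norm (\<Omega> 1) (grad (\<Omega> 1) (u 1 1)))\<^sup>2 + (L2_norm (\<Omega> 2) (grad (\<Omega> 2) (u 2 1)))\<^sup>2)
      + dt * (\<Sum>n=1..M. inverse (\<nu> 1) * (Hm1_norm (\<Omega> 1) (f 1 (real (n + 1) * dt)))\<^sup>2
                        + inverse (\<nu> 2) * (Hm1_norm (\<Omega> 2) (f 2 (real (n + 1) * dt)))\<^sup>2)"
proof -
  have poly: "polyhedral_domain (\<Omega> i)" if "i \<in> {1, 2}" for i
    using dom that by (auto simp: coupled_domains_def)
  have I: "I \<in> sets borel" "I \<subseteq> frontier (\<Omega> 1)" "I \<subseteq> frontier (\<Omega> 2)"
    using dom by (auto simp: coupled_domains_def)
  have card: "CARD('d) \<ge> 2" using dim by auto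
  have "emeasure surface_measure I \<le> emeasure surface_measure (frontier (\<Omega> 1))"
    using I by (intro emeasure_mono) (auto intro: sets_surface_measure_borel)
  also have "\<dots> < \<infinity>"
    using surface_measure_frontier_polyhedral_domain[OF _ card] poly by blast
  finally have I_fin: "emeasure surface_measure I < \<infinity>" .
  have step: "gavms_step \<Omega> I Vh LH \<nu> \<nu>T \<kappa> dt f u G n i j"
    if "n \<in> {1..M}" "(i, j) \<in> {(1, 2), (2, 1)}" for n i j
    using scheme that by (auto simp: gavms_solution_def)
  have mem: "u i n \<in> Vh i" if "i \<in> {1, 2}" "n \<le> M + 1" for i n
  proof (cases "n \<le> 1")
    case True
    then have "n = 0 \<or> n = 1" by linarith
    then show ?thesis using scheme that unfolding gavms_solution_def by metis
  next
    case False
    with that have "n - 1 \<in> {1..M}" "n - 1 + 1 = n" by auto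
    \<comment> \<open>Level \<open>n\<close> is produced by step \<open>n - 1\<close>;
      \<open>3 - i\<close> is the index of the other subdomain.\<close>
    with step[of "n - 1" i "3 - i"] that show ?thesis by (auto simp: gavms_step_def)
  qed
  have Xh: "u i n \<in> Xh i" if "i \<in> {1, 2}" "n \<le> M + 1" for i n
    using mem[OF that] Vh[OF that(1)] by (simp add: V_space_def)
  have H1: "u i n \<in> H1 (\<Omega> i)" if "i \<in> {1, 2}" "n \<le> M + 1" for i n
    using Xh[OF that] fem[OF that(1)] by (auto simp: conforming_fe_pair_def X_space_def)
  have tr: "bounded_on_interface I (btrace (\<Omega> i) (u i n))" if "i \<in> {1, 2}" "n \<le> M + 1" for i n
    using bounded_on_interface_btrace[OF poly fem Xh I(1)] I(2,3) that by auto
  have sqrt_tr: "bounded_on_interface I (\<lambda>x. sqrt (jump_norm \<Omega> u n x) *\<^sub>R btrace (\<Omega> i) (u i m) x)"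
    if "i \<in> {1, 2}" "n \<le> M + 1" "m \<le> M + 1" for i n m
    using that by (intro bounded_on_interface_sqrt_jump tr) auto
  have jump: "0 \<le> jump_norm \<Omega> u n x" for n x by (simp add: jump_norm_def)
  define e where "e i n = (L2_norm (\<Omega> i) (u i n))\<^sup>2" for i n
  define g where "g i n = (L2_norm (\<Omega> i) (grad (\<Omega> i) (u i n)))\<^sup>2" for i n
  \<comment> \<open>The weight lags one level behind the velocity: at step \<open>n\<close> the
    positive square is \<open>A i (n + 1)\<close> and the negative one is
    \<open>A j n\<close>.\<close>
  define A where "A i n = surface_integral I (\<lambda>x. jump_norm \<Omega> u (n - 1) x *
      (norm (btrace (\<Omega> i) (u i n) x))\<^sup>2)" for i n
  define S where "S i j n = surface_integral I (\<lambda>x.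
      (norm (sqrt (jump_norm \<Omega> u n x) *\<^sub>R btrace (\<Omega> i) (u i (n + 1)) x
             - sqrt (jump_norm \<Omega> u (n - 1) x) *\<^sub>R btrace (\<Omega> j) (u j n) x))\<^sup>2)" for i j n
  define r where "r i n = inverse (\<nu> i) * (Hm1_norm (\<Omega> i) (f i (real (n + 1) * dt)))\<^sup>2" for i n
  have energy: "e i (n + 1) - e i n + \<nu> i * dt * g i (n + 1) + \<nu>T * dt * (g i (n + 1) - g i n)
      + \<kappa> * dt * (A i (n + 1) - A j n + S i j n) \<le> dt * r i n"
    if n: "n \<in> {1..M}" and ij: "(i, j) \<in> {(1, 2), (2, 1)}" for n i j
  proof -
    have i: "i \<in> {1, 2}" "j \<in> {1, 2}" "\<nu> i > 0" using ij \<nu> by auto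
    have le: "n \<le> M + 1" "n + 1 \<le> M + 1" "n - 1 \<le> M + 1" using n by auto
    note * = interface_polarization[OF I(1) I_fin sqrt_tr[OF i(1) le(1,2)] sqrt_tr[OF i(2) le(3,1)] jump jump]
    show ?thesis
      using gavms_step_energy[OF step[OF n ij] H1[OF i(1) le(1)] H1[OF i(1) le(2)] _ i(3) \<nu>T dt
          f_levels[OF i(1) n]] LH[OF i(1)]
      unfolding * by (simp add: e_def g_def A_def S_def r_def)
  qed
  \<comment> \<open>In \<open>energy\<close> the interface difference is crossed between the
    subdomains, so only the sum over both telescopes. \<open>E\<close> collects what telescopes,
    \<open>d\<close> the dissipation of one step.\<close>
  define E where "E n = e 1 n + e 2 n + \<nu>T * dt * (g 1 n + g 2 n) + \<kappa> * dt * (A 1 n + A 2 n)" for n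
  define d where "d n = \<nu> 1 * dt * g 1 (n + 1) + \<nu> 2 * dt * g 2 (n + 1)
      + \<kappa> * dt * S 1 2 n + \<kappa> * dt * S 2 1 n" for n
  have "E (M + 1) + (\<Sum>n=1..M. d n) \<le> E 1 + (\<Sum>n=1..M. dt * (r 1 n + r 2 n))"
  proof (rule telescoping_inequality)
    fix n assume "n \<in> {1..M}"
    then show "E (n + 1) + d n \<le> E n + dt * (r 1 n + r 2 n)"
      using energy[of n 1 2] energy[of n 2 1] by (simp add: E_def d_def algebra_simps)
  qed
  \<comment> \<open>The joint interface integral is split only at levels \<open>M + 1\<close> and 1,
    the two ends of the telescoped sum.\<close>
  moreover have "surface_integral I (\<lambda>x. jump_norm \<Omega> u (n - 1) x *
      ((norm (btrace (\<Omega> 1) (u 1 n) x))\<^sup>2 + (norm (btrace (\<Omega> 2) (u 2 n) x))\<^sup>2)) = A 1 n + A 2 n"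
    if "n \<le> M + 1" for n
    unfolding A_def using that by (intro surface_integral_distrib_add I(1) I_fin sqrt_tr jump) auto
  from this[of "M + 1"] this[of 1]
  have "surface_integral I (\<lambda>x. jump_norm \<Omega> u M x *
      ((norm (btrace (\<Omega> 1) (u 1 (M + 1)) x))\<^sup>2 + (norm (btrace (\<Omega> 2) (u 2 (M + 1)) x))\<^sup>2))
      = A 1 (M + 1) + A 2 (M + 1)"
    "surface_integral I (\<lambda>x. jump_norm \<Omega> u 0 x *
      ((norm (btrace (\<Omega> 1) (u 1 1) x))\<^sup>2 + (norm (btrace (\<Omega> 2) (u 2 1) x))\<^sup>2)) = A 1 1 + A 2 1"
    by simp_all
  ultimately show ?thesis
    unfolding e_def[symmetric] g_def[symmetric] S_def[symmetric] r_def[symmetric]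
    by (simp add: E_def d_def sum.distrib flip: sum_distrib_left)
qed

end
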